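(* Let $q=p^k$ be a power of a prime $p$ with $q\equiv 1\pmod 4$ and let $f:\mathbb{F}_q\to\mathbb{F}_q$ be a function. Then the following are equivalent: (1) $f$ preserves positivity on $M_n(\mathbb{F}_q)$ for some $n\ge 3$. (2) $f$ preserves positivity on $M_n(\mathbb{F}_q)$ for all $n\ge 3$. (3) $f(0)=0$ and $\eta(f(a)-f(b))=\eta(a-b)$ for all $a,b\in\mathbb{F}_q$. (4) $f$ is a positive multiple of a field automorphism of $\mathbb{F}_q$, i.e., there exist $c\in\mathbb{F}_q^+$ and $0\le\ell\le k-1$ such that $f(x)=cx^{p^\ell}$ for all $x\in\mathbb{F}_q$. Moreover, when $q=r^2$ for some odd integer $r$, conditions (1), (2), (3) and (4) are equivalent to (1') $f$ preserves positivity on $M_n(\mathbb{F}_q)$ for some $n\ge 2$.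
   Context: $\mathbb{F}_q$ is the finite field with $q$ elements, $\mathbb{F}_q^*=\mathbb{F}_q\setminus\{0\}$, $\mathbb{F}_q^+:=\{x^2:x\in\mathbb{F}_q^*\}$ is the set of positive elements, and $\mathbb{F}_q^-=\mathbb{F}_q^*\setminus\mathbb{F}_q^+$. For $q$ odd, the quadratic character $\eta:\mathbb{F}_q\to\{-1,0,1\}$ is given by $\eta(x)=1$ if $x\in\mathbb{F}_q^+$, $\eta(x)=-1$ if $x\in\mathbb{F}_q^-$, and $\eta(0)=0$. $M_n(\mathbb{F}_q)$ is the set of $n\times n$ matrices over $\mathbb{F}_q$. A matrix $A\in M_n(\mathbb{F}_q)$ is positive definite if $A$ is symmetric and all its leading principal minors are non-zero squares in $\mathbb{F}_q$. For $A=(a_{ij})$, write $f[A]:=(f(a_{ij}))$. The function $f$ preserves positivity on $M_n(\mathbb{F}_q)$ if $f[A]$ is positive definite for every positive definite $A\in M_n(\mathbb{F}_q)$. *)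

theory Defs
  imports
    "Jordan_Normal_Form.Determinant"
    "Jordan_Normal_Form.DL_Submatrix"
    "HOL-Computational_Algebra.Primes"
begin

definition pos_elems :: "'a::field set" where
  "pos_elems = {x ^ 2 | x. x \<noteq> 0}"

definition neg_elems :: "'a::field set" where
  "neg_elems = (UNIV - {0}) - pos_elems"

definition quad_char :: "'a::field \<Rightarrow> int" where
  "quad_char x = (if x \<in> pos_elems then 1 else if x \<in> neg_elems then -1 else 0)"

text \<open>Matrix indices start at 0, so the leading principal minors of an \<open>n \<times> n\<close> matrix are the
  determinants of the submatrices on \<open>{..<m}\<close> with \<open>m = 1, \<dots>, n\<close>.\<close>

definition positive_definite :: "'a::field mat \<Rightarrow> bool" where
  "positive_definite A \<longleftrightarrow> square_mat A \<and> transpose_mat A = A \<and>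
     (\<forall>m\<in>{1..dim_row A}. det (submatrix A {..<m} {..<m}) \<in> pos_elems)"

definition preserves_positivity :: "nat \<Rightarrow> ('a::field \<Rightarrow> 'a) \<Rightarrow> bool" where
  "preserves_positivity n f \<longleftrightarrow>
     (\<forall>A\<in>carrier_mat n n. positive_definite A \<longrightarrow> positive_definite (map_mat f A))"

definition field_automorphism :: "('a::field \<Rightarrow> 'a) \<Rightarrow> bool" where
  "field_automorphism \<sigma> \<longleftrightarrow> field_hom \<sigma> \<and> bij \<sigma>"

end

theory Submission
  imports Defs
begin

text \<open>
  Throughout, \<open>q = 2m + 1\<close> with \<open>m\<close> even is the size of the field and \<open>P\<close> is the set of nonzero
  squares, so that \<open>-1 \<in> P\<close> and "\<open>x - y \<in> P\<close>" is a symmetric relation: adjacency in the Paley graph.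

  A scaled automorphism commutes with determinants up to a power of the scalar, which gives positivity
  in every dimension. For the way back, bordering by an identity block shows that a preserver in
  dimension \<open>n\<close> is one in every smaller dimension, and the binary matrices alone say: if \<open>a \<in> P\<close> and
  \<open>ac - b\<^sup>2 \<in> P\<close>, then the same holds for the images under \<open>f\<close>.

  Suppose first that \<open>f\<close> is injective. Finiteness turns this implication into an equivalence. For
  fixed \<open>a, b\<close> it says that \<open>f\<close> carries the neighbours of \<open>b\<^sup>2/a\<close> to the neighbours of \<open>f(b)\<^sup>2/f(a)\<close>, and
  a vertex is determined by its neighbours; hence \<open>f(b\<^sup>2/a) = f(b)\<^sup>2/f(a)\<close>, and \<open>f/f(1)\<close> is
  multiplicative on \<open>P\<close>. A nonsquare is already determined by its neighbours inside \<open>P\<close>, which extends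
  multiplicativity to products of a square and a nonsquare. Then every difference \<open>a - b\<close> can be
  divided by \<open>b\<close>, and \<open>f\<close> preserves the quadratic character of differences
  (\<open>injective_binary_preserver_quad_char\<close>).

  Injectivity is where the hypotheses differ. Ternary matrices give it from one matrix in which
  \<open>f(u) = f(v)\<close> would produce two equal columns (\<open>ternary_preserver_inj\<close>); only the field of \<open>5\<close>
  elements, which is too small for such a matrix to exist, is treated by a calculation. For binary matrices over a
  field of size \<open>r\<^sup>2\<close> it comes from the lines \<open>sK\<close>, where \<open>K\<close> is the subfield of size \<open>r\<close> and
  \<open>s \<in> P\<close>. They are cliques of size \<open>r\<close>, their images are again cliques of size \<open>r\<close>, and a second moment
  computation shows that a vertex outside such a clique always has exactly \<open>(r-1)/2\<close> neighbours in it.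
  As \<open>f\<close> preserves adjacency in one direction, these equal counts force the other direction
  (\<open>binary_preserver_inj\<close>).

  That a map preserving the character is a monomial is a theorem of Carlitz. The functions
  \<open>x \<mapsto> (x - y)\<^sup>m\<close> span a space of polynomial functions of degree at most \<open>m\<close>, and this space is stable
  under the Frobenius map and under composition with \<open>f\<close>. It contains \<open>x\<^sup>t\<close> whenever the binomial
  coefficient of \<open>m\<close> over \<open>t\<close> is nonzero in the field, so all powers \<open>f\<^sup>t\<close> with such \<open>t\<close> have degree at
  most \<open>m\<close>. Comparing with the degrees of products of powers of the maps \<open>f^(p^r)\<close> leaves only one
  exponent for \<open>f\<close>, a power of \<open>p\<close> (\<open>quad_char_preserver_is_monomial\<close>).
\<close>

section \<open>Squares and the quadratic character\<close>

lemma pos_elems_iff: "x \<in> pos_elems \<longleftrightarrow> (\<exists>y. y \<noteq> 0 \<and> x = y ^ 2)"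
  by (auto simp: pos_elems_def)

lemma zero_notin_pos_elems [simp]: "0 \<notin> pos_elems"
  by (auto simp: pos_elems_iff)

lemma one_in_pos_elems [simp]: "1 \<in> pos_elems"
  unfolding pos_elems_iff by (rule exI[of _ 1]) simp

lemma square_in_pos_elems: "y \<noteq> 0 \<Longrightarrow> y ^ 2 \<in> pos_elems"
  by (auto simp: pos_elems_iff)

lemma pos_elems_mult: "x \<in> pos_elems \<Longrightarrow> y \<in> pos_elems \<Longrightarrow> x * y \<in> pos_elems"
  unfolding pos_elems_iff by (metis mult_eq_0_iff power_mult_distrib)

lemma pos_elems_inverse: "x \<in> pos_elems \<Longrightarrow> inverse x \<in> pos_elems"
  unfolding pos_elems_iff by (metis inverse_nonzero_iff_nonzero power_inverse)

lemma pos_elems_divide: "x \<in> pos_elems \<Longrightarrow> y \<in> pos_elems \<Longrightarrow> x / y \<in> pos_elems"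
  by (simp add: divide_inverse pos_elems_mult pos_elems_inverse)

lemma pos_elems_power: "x \<in> pos_elems \<Longrightarrow> x ^ n \<in> pos_elems"
  by (induction n) (auto intro: pos_elems_mult)

lemma pos_elems_mult_iff:
  assumes "c \<in> pos_elems"
  shows "c * x \<in> pos_elems \<longleftrightarrow> x \<in> pos_elems"
proof
  assume "c * x \<in> pos_elems"
  hence "c * x / c \<in> pos_elems" using assms by (rule pos_elems_divide)
  thus "x \<in> pos_elems" using assms by (cases "c = 0") auto
qed (use assms pos_elems_mult in blast)

lemma quad_char_eq_1_iff: "quad_char x = 1 \<longleftrightarrow> x \<in> pos_elems"
  by (auto simp: quad_char_def)

lemma quad_char_eq_0_iff: "quad_char x = 0 \<longleftrightarrow> x = 0"
  by (auto simp: quad_char_def neg_elems_def)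

lemma quad_char_zero [simp]: "quad_char 0 = 0"
  by (simp add: quad_char_eq_0_iff)

lemma quad_char_cases: "quad_char x = 0 \<or> quad_char x = 1 \<or> quad_char x = - 1"
  by (auto simp: quad_char_def)

lemma quad_char_eqI:
  assumes "x = 0 \<longleftrightarrow> y = 0" and "x \<in> pos_elems \<longleftrightarrow> y \<in> pos_elems"
  shows "quad_char x = quad_char y"
  using assms by (auto simp: quad_char_def neg_elems_def)

text \<open>
  The field enters as a type, so it can be fixed only through an argument of type \<open>itself\<close>. Its size is
  written as \<open>2 * m + 1\<close> because almost every exponent below is \<open>m\<close> or \<open>2 * m\<close>; a size congruent to
  \<open>1\<close> modulo \<open>4\<close> means that \<open>m\<close> is even.
\<close>

locale paley_field =
  fixes field_type :: "'a::finite_field itself" and m :: nat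
  assumes card_field: "card (UNIV :: 'a set) = 2 * m + 1" and even_m: "even m"
begin

abbreviation P :: "'a set" where "P \<equiv> pos_elems"

lemma m_ge_2: "m \<ge> 2"
proof -
  have "card {0, 1 :: 'a} \<le> 2 * m + 1"
    unfolding card_field[symmetric] by (rule card_mono) auto
  thus ?thesis using even_m by (cases "m = 1") auto
qed

text \<open>
  In the field \<open>m\<close> is \<open>-1/2\<close>, since \<open>q\<close> vanishes: translation by \<open>1\<close> permutes the field, so it does
  not change the sum of all elements. In particular the characteristic is odd and does not divide \<open>m\<close>.
\<close>

lemma two_m: "2 * of_nat m = (- 1 :: 'a)"
proof -
  have "(\<Sum>x::'a\<in>UNIV. x + 1) = (\<Sum>x\<in>UNIV. x)"
    by (rule sum.reindex_bij_witness[of _ "\<lambda>x. x - 1" "\<lambda>x. x + 1"]) auto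
  hence "(of_nat (2 * m + 1) :: 'a) = 0"
    unfolding card_field[symmetric] by (simp add: sum.distrib)
  hence "1 + 2 * of_nat m = (0 :: 'a)" by (simp add: add.commute)
  thus ?thesis by (simp only: add_eq_0_iff)
qed

lemma of_nat_m_nonzero: "of_nat m \<noteq> (0 :: 'a)"
  using two_m by auto

lemma two_nonzero: "(2 :: 'a) \<noteq> 0"
  using two_m by auto

lemma power_two_m: "x ^ (2 * m) = 1" if "x \<noteq> (0 :: 'a)"
proof -
  have "x * x ^ (2 * m) = x * 1"
    using finite_field_power_card_eq_same[of x] unfolding card_field by simp
  thus ?thesis using that mult_left_cancel by blast
qed

lemma card_power_fibre_le:
  assumes "n > 0"
  shows "card {x :: 'a. x ^ n = s} \<le> n"
proof -
  have "{x. x ^ n = s} = {x. poly (monom 1 n - [:s:]) x = 0}"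
    by (simp add: poly_monom)
  moreover have deg: "degree (monom 1 n - [:s:] :: 'a poly) = n"
    using assms by (subst diff_conv_add_uminus, subst degree_add_eq_left) (auto simp: degree_monom_eq)
  moreover have "monom 1 n - [:s:] \<noteq> (0 :: 'a poly)"
    using deg assms by (metis degree_0 less_irrefl)
  ultimately show ?thesis
    by (metis card_poly_roots_bound)
qed

text \<open>
  The map \<open>y \<mapsto> y\<^sup>b\<close> sends the \<open>ab\<close> nonzero elements into the \<open>a\<close>-th roots of unity, at most \<open>b\<close> to
  one, so there are at least \<open>a\<close> roots; a polynomial of degree \<open>a\<close> has no more. The case \<open>b = 2\<close> is
  Euler's criterion; \<open>a = r - 1\<close> will give the subfield of size \<open>r\<close>.
\<close>

lemma card_roots_of_unity:
  assumes "a * b = 2 * m"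
  shows "card {x :: 'a. x ^ a = 1} = a"
    and "{x :: 'a. x ^ a = 1} = (\<lambda>y. y ^ b) ` (UNIV - {0})"
proof -
  let ?I = "(\<lambda>y :: 'a. y ^ b) ` (UNIV - {0})"
  have pos: "a > 0" "b > 0" using assms m_ge_2 by (auto intro: Nat.gr0I)
  have sub: "?I \<subseteq> {x. x ^ a = 1}"
    using power_two_m assms by (auto simp: mult.commute simp flip: power_mult)
  have le: "card {x :: 'a. x ^ a = 1} \<le> a"
    by (rule card_power_fibre_le[OF pos(1)])
  have "(\<Union>s\<in>?I. {y. y ^ b = s}) \<supseteq> UNIV - {0}"
    by auto
  hence "card (UNIV - {0 :: 'a}) \<le> card (\<Union>s\<in>?I. {y. y ^ b = s})"
    by (intro card_mono) auto
  also have "\<dots> \<le> (\<Sum>s\<in>?I. b)"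
    by (intro order_trans[OF card_UN_le] sum_mono card_power_fibre_le pos) auto
  finally have "a * b \<le> card ?I * b"
    by (simp add: card_field card_Diff_singleton assms)
  hence ge: "a \<le> card ?I" using pos by simp
  show eq: "{x :: 'a. x ^ a = 1} = ?I"
    using le ge by (intro card_seteq[OF _ sub, symmetric]) auto
  show "card {x :: 'a. x ^ a = 1} = a"
    using le ge unfolding eq by simp
qed

lemma Euler_criterion: "x \<in> P \<longleftrightarrow> x ^ m = 1"
  and card_pos_elems: "card P = m"
proof -
  have "P = {x. x ^ m = 1}"
    using card_roots_of_unity(2)[of m 2] by (auto simp: pos_elems_iff)
  thus "x \<in> P \<longleftrightarrow> x ^ m = 1" "card P = m"
    using card_roots_of_unity(1)[of m 2] by auto
qed

lemma power_m_nonsquare: "x ^ m = - 1" if "x \<noteq> 0" "x \<notin> P"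
proof -
  have "(x ^ m) ^ 2 = 1"
    using power_two_m[OF that(1)] by (simp add: mult.commute flip: power_mult)
  thus ?thesis using that by (auto simp: power2_eq_1_iff Euler_criterion)
qed

lemma neg_one_pos: "- 1 \<in> P"
  using even_m by (simp add: Euler_criterion)

lemma minus_pos_iff: "- x \<in> P \<longleftrightarrow> x \<in> P"
  using pos_elems_mult_iff[OF neg_one_pos, of x] by simp

lemma diff_pos_commute: "x - y \<in> P \<longleftrightarrow> y - x \<in> P"
  using minus_pos_iff[of "x - y"] by simp

lemma nonsquare_mult_iff:
  assumes "c \<notin> P" "c \<noteq> 0"
  shows "c * x \<in> P \<longleftrightarrow> x \<noteq> 0 \<and> x \<notin> P"
proof (cases "x = 0")
  case False
  have "(-1 :: 'a) \<noteq> 1" using two_nonzero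
    by (metis add_neg_numeral_special(7) one_add_one)
  moreover have "x ^ m = 1 \<or> x ^ m = - 1"
    using False power_m_nonsquare Euler_criterion by blast
  ultimately show ?thesis using False assms power_m_nonsquare[OF assms(2,1)]
    by (auto simp: Euler_criterion power_mult_distrib)
qed auto

lemma of_int_quad_char: "of_int (quad_char x) = (x :: 'a) ^ m"
  using m_ge_2 Euler_criterion[of x] power_m_nonsquare[of x]
  by (auto simp: quad_char_def neg_elems_def)

lemma quad_char_mult: "quad_char (x * y) = quad_char x * quad_char (y :: 'a)"
  using nonsquare_mult_iff[of x y] pos_elems_mult_iff[of x y]
  by (auto simp: quad_char_def neg_elems_def)

lemma nonsquare_divide: "a \<noteq> 0 \<Longrightarrow> a \<notin> P \<Longrightarrow> b \<noteq> 0 \<Longrightarrow> b \<notin> P \<Longrightarrow> a / b \<in> P"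
  using nonsquare_mult_iff[of b "a / b"] by auto

lemma card_translate: "card {x. x - w \<in> P} = m"
proof -
  have "bij_betw (\<lambda>s. s + w) P {x. x - w \<in> P}"
    by (rule bij_betwI[of _ _ _ "\<lambda>x. x - w"]) auto
  thus ?thesis using card_pos_elems bij_betw_same_card by metis
qed

text \<open>
  A vertex of the Paley graph is determined by its neighbours: the sum of the neighbours of \<open>w\<close> is
  \<open>\<Sum>P + mw\<close>, and \<open>m\<close> is invertible.
\<close>

lemma translates_of_pos_elems_distinct:
  assumes "\<And>x. x - u \<in> P \<longleftrightarrow> x - v \<in> P"
  shows "u = v"
proof -
  have *: "(\<Sum>x | x - w \<in> P. x) = \<Sum>P + of_nat m * w" for w
  proof -
    have "(\<Sum>x | x - w \<in> P. x) = (\<Sum>s\<in>P. s + w)"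
      by (rule sum.reindex_bij_witness[of _ "\<lambda>s. s + w" "\<lambda>x. x - w"]) auto
    thus ?thesis by (simp add: sum.distrib card_pos_elems)
  qed
  have "\<Sum>P + of_nat m * u = \<Sum>P + of_nat m * v"
    unfolding *[symmetric] by (simp add: assms)
  hence "of_nat m * u = of_nat m * v" by simp
  thus ?thesis using of_nat_m_nonzero mult_left_cancel by blast
qed

text \<open>
  Only the neighbours inside \<open>P\<close> are compared here. For \<open>u, v\<close> outside \<open>P\<close> no difference \<open>s - u\<close> or
  \<open>s - v\<close> with \<open>s \<in> P\<close> vanishes, so having the same neighbours means \<open>(s - u)\<^sup>m = (s - v)\<^sup>m\<close> for all
  \<open>m\<close> elements \<open>s\<close> of \<open>P\<close>. Both sides are monic polynomials of degree \<open>m\<close> in \<open>s\<close>, hence equal, and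
  the coefficients of degree \<open>m - 1\<close> are \<open>-mu\<close> and \<open>-mv\<close>.
\<close>

lemma nonpos_determined_by_pos_neighbours:
  assumes "u \<notin> P" "v \<notin> P" and adj: "\<And>s. s \<in> P \<Longrightarrow> s - u \<in> P \<longleftrightarrow> s - v \<in> P"
  shows "u = v"
proof -
  have deg: "degree ([:- w, 1:] ^ m) \<le> m" for w :: 'a
    by (rule order_trans[OF degree_power_le]) auto
  have "[:- u, 1:] ^ m = [:- v, 1:] ^ m"
  proof (rule poly_eqI_degree_lead_coeff)
    show "coeff ([:- u, 1:] ^ m) m = coeff ([:- v, 1:] ^ m) m"
      by (simp add: coeff_linear_power)
    fix s assume "s \<in> P"
    hence "s - u \<noteq> 0" "s - v \<noteq> 0" using assms by auto
    hence "(s - u) ^ m = (s - v) ^ m"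
      using adj[OF \<open>s \<in> P\<close>] power_m_nonsquare Euler_criterion by metis
    thus "poly ([:- u, 1:] ^ m) s = poly ([:- v, 1:] ^ m) s"
      by simp
  qed (use deg card_pos_elems in auto)
  hence "coeff ([:- u, 1:] ^ m) (m - 1) = coeff ([:- v, 1:] ^ m) (m - 1)"
    by simp
  moreover have "coeff ([:- w, 1:] ^ m) (m - 1) = - (of_nat m * w)" for w :: 'a
  proof -
    have "m choose (m - 1) = m" "m - (m - 1) = 1"
      using m_ge_2 binomial_symmetric[of 1 m] by auto
    thus ?thesis by (simp add: coeff_linear_poly_power)
  qed
  ultimately show ?thesis using of_nat_m_nonzero by (metis mult_left_cancel neg_equal_iff_equal)
qed

end

section \<open>Leading blocks and small determinants\<close>

definition leading_block :: "nat \<Rightarrow> 'a mat \<Rightarrow> 'a mat" where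
  "leading_block k A = mat k k (\<lambda>ij. A $$ ij)"

lemma submatrix_eq_leading_block:
  assumes "A \<in> carrier_mat n n" "k \<le> n"
  shows "submatrix A {..<k} {..<k} = leading_block k A"
proof -
  have pick: "pick {..<k} i = i" if "i < k" for i
  proof -
    have "{a \<in> {..<k}. a < i} = {..<i}" using that by auto
    thus ?thesis using pick_card_in_set[of i "{..<k}"] that by simp
  qed
  have "{i. i < n \<and> i \<in> {..<k}} = {..<k}" using assms by auto
  thus ?thesis using assms unfolding submatrix_def leading_block_def
    by (intro eq_matI) (auto simp: pick)
qed

lemma positive_definite_iff_leading_blocks:
  assumes "A \<in> carrier_mat n n"
  shows "positive_definite A \<longleftrightarrow>
    transpose_mat A = A \<and> (\<forall>k\<in>{1..n}. det (leading_block k A) \<in> pos_elems)"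
  using assms submatrix_eq_leading_block[OF assms] unfolding positive_definite_def by auto

lemma leading_block_map_mat:
  assumes "A \<in> carrier_mat n n" "k \<le> n"
  shows "leading_block k (map_mat f A) = map_mat f (leading_block k A)"
  using assms unfolding leading_block_def by (intro eq_matI) auto

lemma leading_block_full: "A \<in> carrier_mat n n \<Longrightarrow> leading_block n A = A"
  unfolding leading_block_def by (intro eq_matI) auto

text \<open>
  Bordering by an identity block leaves the small leading minors unchanged and makes all larger ones
  equal to the full determinant, so positive definiteness can be tested in a larger dimension.
\<close>

lemma preserves_positivity_mono:
  assumes pres: "preserves_positivity n f" and "1 \<le> k" "k \<le> n"
  shows "preserves_positivity k (f :: 'a::field \<Rightarrow> 'a)"
  unfolding preserves_positivity_def
proof (intro ballI impI)
  fix A :: "'a mat" assume A: "A \<in> carrier_mat k k" and "positive_definite A"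
  hence sym: "transpose_mat A = A" and minors: "\<And>j. j \<in> {1..k} \<Longrightarrow> det (leading_block j A) \<in> pos_elems"
    by (auto simp: positive_definite_iff_leading_blocks)
  let ?B = "\<lambda>l. four_block_mat A (0\<^sub>m k l) (0\<^sub>m l k) (1\<^sub>m l)"
  have B: "?B l \<in> carrier_mat (k + l) (k + l)" for l using A by auto
  have B': "?B (n - k) \<in> carrier_mat n n" using B[of "n - k"] \<open>k \<le> n\<close> by simp
  have small: "leading_block j (?B l) = leading_block j A" if "j \<le> k" for j l
    using A that unfolding leading_block_def by (intro eq_matI) auto
  have "positive_definite (?B (n - k))"
    unfolding positive_definite_iff_leading_blocks[OF B']
  proof (intro conjI ballI)
    show "transpose_mat (?B (n - k)) = ?B (n - k)"
      using A sym by (subst transpose_four_block_mat[OF A]) auto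
    fix j assume j: "j \<in> {1..n}"
    show "det (leading_block j (?B (n - k))) \<in> pos_elems"
    proof (cases "j \<le> k")
      case True
      thus ?thesis using small minors j by auto
    next
      case False
      have "leading_block j (?B (n - k)) = ?B (j - k)"
        using A False j unfolding leading_block_def by (intro eq_matI) auto
      moreover have "det (?B (j - k)) = det A"
        using A by (subst det_four_block_mat_lower_left_zero[of _ k _ "j - k"]) auto
      ultimately show ?thesis
        using minors[of k] \<open>1 \<le> k\<close> leading_block_full[OF A] by simp
    qed
  qed
  hence PB: "positive_definite (map_mat f (?B (n - k)))"
    using pres B' unfolding preserves_positivity_def by blast
  have fB: "map_mat f (?B (n - k)) \<in> carrier_mat n n" using B' by simp
  show "positive_definite (map_mat f A)"
  proof (subst positive_definite_iff_leading_blocks[of _ k])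
    show "map_mat f A \<in> carrier_mat k k" using A by simp
    have "det (leading_block j (map_mat f A)) \<in> pos_elems" if j: "j \<in> {1..k}" for j
    proof -
      have "det (leading_block j (map_mat f (?B (n - k)))) \<in> pos_elems"
        using PB j \<open>k \<le> n\<close> unfolding positive_definite_iff_leading_blocks[OF fB] by auto
      thus ?thesis
        using small[of j "n - k"] j \<open>k \<le> n\<close> by (simp add: leading_block_map_mat[OF B'] leading_block_map_mat[OF A])
    qed
    moreover have "transpose_mat (map_mat f A) = map_mat f (transpose_mat A)"
      by (intro eq_matI) auto
    ultimately show "transpose_mat (map_mat f A) = map_mat f A \<and>
      (\<forall>j\<in>{1..k}. det (leading_block j (map_mat f A)) \<in> pos_elems)"
      by (simp add: sym)
  qed
qed

lemma det_mat_2: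
  "det (mat 2 2 g) = g (0, 0) * g (1, 1) - g (0, 1) * (g (1, 0) :: 'a::comm_ring_1)"
proof -
  have "{..<2} = {0, 1 :: nat}" by auto
  thus ?thesis
    by (subst laplace_expansion_column[of _ 2 0])
      (auto simp: cofactor_def mat_delete_def det_single)
qed

lemma det_mat_3:
  "det (mat 3 3 g) = g (0, 0) * (g (1, 1) * g (2, 2) - g (1, 2) * g (2, 1))
     - g (1, 0) * (g (0, 1) * g (2, 2) - g (0, 2) * g (2, 1))
     + g (2, 0) * (g (0, 1) * g (1, 2) - g (0, 2) * (g (1, 1) :: 'a::comm_ring_1))"
proof -
  have minor: "mat_delete (mat 3 3 g) i 0 = mat 2 2 (\<lambda>(a, b). g (if a < i then a else a + 1, b + 1))"
    if "i < 3" for i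
    using that unfolding mat_delete_def by (intro eq_matI) auto
  have "{..<3} = {0, 1, 2 :: nat}" by auto
  hence "det (mat 3 3 g) = g (0, 0) * cofactor (mat 3 3 g) 0 0
      + (g (1, 0) * cofactor (mat 3 3 g) 1 0 + g (2, 0) * cofactor (mat 3 3 g) 2 0)"
    by (subst laplace_expansion_column[of _ 3 0]) auto
  thus ?thesis
    unfolding cofactor_def by (simp add: minor det_mat_2) (simp add: numeral_2_eq_2 algebra_simps)
qed

text \<open>
  Preservation of positivity for the matrices with rows \<open>a, b\<close> and \<open>b, c\<close>, spelled out in terms of
  their leading minors.
\<close>

definition preserves_binary_positivity :: "('a::field \<Rightarrow> 'a) \<Rightarrow> bool" where
  "preserves_binary_positivity f \<longleftrightarrow>
     (\<forall>a b c. a \<in> pos_elems \<and> a * c - b ^ 2 \<in> pos_elems \<longrightarrow>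
        f a \<in> pos_elems \<and> f a * f c - f b ^ 2 \<in> pos_elems)"

lemma positive_definite_2_iff:
  "positive_definite (mat 2 2 (\<lambda>(i, j). [[a, b], [b, c]] ! i ! j)) \<longleftrightarrow>
     a \<in> pos_elems \<and> a * c - b ^ 2 \<in> pos_elems"
proof -
  have "{1..2} = {1, 2 :: nat}" by auto
  moreover have "leading_block 1 (mat 2 2 (\<lambda>(i, j). [[a, b], [b, c]] ! i ! j)) = mat 1 1 (\<lambda>_. a)"
    unfolding leading_block_def by (intro eq_matI) auto
  moreover have "transpose_mat (mat 2 2 (\<lambda>(i, j). [[a, b], [b, c]] ! i ! j)) =
      mat 2 2 (\<lambda>(i, j). [[a, b], [b, c]] ! i ! j)"
    by (intro eq_matI) (auto simp: less_2_cases_iff)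
  ultimately show ?thesis
    by (subst positive_definite_iff_leading_blocks[of _ 2])
      (auto simp: leading_block_full[of _ 2] det_mat_2 det_single power2_eq_square)
qed

lemma preserves_binary_positivity_if_2:
  fixes f :: "'a::field \<Rightarrow> 'a"
  assumes "preserves_positivity 2 f"
  shows "preserves_binary_positivity f"
  unfolding preserves_binary_positivity_def
proof (intro allI impI)
  fix a b c :: 'a assume "a \<in> pos_elems \<and> a * c - b ^ 2 \<in> pos_elems"
  hence "positive_definite (map_mat f (mat 2 2 (\<lambda>(i, j). [[a, b], [b, c]] ! i ! j)))"
    using assms unfolding preserves_positivity_def by (simp add: positive_definite_2_iff)
  also have "map_mat f (mat 2 2 (\<lambda>(i, j). [[a, b], [b, c]] ! i ! j)) =
      mat 2 2 (\<lambda>(i, j). [[f a, f b], [f b, f c]] ! i ! j)"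
    by (intro eq_matI) (auto simp: less_2_cases_iff)
  finally show "f a \<in> pos_elems \<and> f a * f c - f b ^ 2 \<in> pos_elems"
    by (simp only: positive_definite_2_iff)
qed

text \<open>
  The matrix with rows \<open>w, u, v\<close> and \<open>u, 1, 1\<close> and \<open>v, 1, 1\<close> has leading minors \<open>w\<close>, \<open>w - u\<^sup>2\<close> and
  \<open>-(u - v)\<^sup>2\<close>; the last one is a square because \<open>-1\<close> is. If \<open>f(u) = f(v)\<close>, its image has two
  equal columns.
\<close>

lemma preserves_positivity_3_separates:
  fixes f :: "'a::field \<Rightarrow> 'a"
  assumes "preserves_positivity 3 f" and "(- 1 :: 'a) \<in> pos_elems"
    and "w \<in> pos_elems" "w - u ^ 2 \<in> pos_elems" and "f u = f v"
  shows "u = v"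
proof (rule ccontr)
  assume "u \<noteq> v"
  let ?g = "\<lambda>w u v e. \<lambda>(i, j). [[w, u, v], [u, e, e], [v, e, e :: 'a]] ! i ! j"
  have A: "mat 3 3 g \<in> carrier_mat 3 3" for g :: "nat \<times> nat \<Rightarrow> 'a" by simp
  have less_3: "i < 3 \<longleftrightarrow> i = 0 \<or> i = 1 \<or> i = 2" for i :: nat by auto
  have "{1..3} = {1, 2, 3 :: nat}" by auto
  moreover have "leading_block 1 (mat 3 3 (?g w u v 1)) = mat 1 1 (\<lambda>_. w)"
    and "leading_block 2 (mat 3 3 (?g w u v 1)) = mat 2 2 (\<lambda>(i, j). [[w, u], [u, 1]] ! i ! j)"
    unfolding leading_block_def by (intro eq_matI; auto simp: less_2_cases_iff)+
  moreover have "transpose_mat (mat 3 3 (?g w u v 1)) = mat 3 3 (?g w u v 1)"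
    by (intro eq_matI) (auto simp: less_3)
  moreover have "det (mat 3 3 (?g w u v 1)) = - 1 * (u - v) ^ 2"
    by (simp add: det_mat_3 power2_eq_square algebra_simps)
  moreover have "- 1 * (u - v) ^ 2 \<in> pos_elems"
    using \<open>u \<noteq> v\<close> assms(2) by (intro pos_elems_mult square_in_pos_elems) auto
  ultimately have "positive_definite (mat 3 3 (?g w u v 1))"
    using assms(3,4) by (subst positive_definite_iff_leading_blocks[OF A])
      (auto simp: leading_block_full[OF A] det_mat_2 det_single power2_eq_square)
  hence "positive_definite (map_mat f (mat 3 3 (?g w u v 1)))"
    using assms(1) A unfolding preserves_positivity_def by blast
  also have "map_mat f (mat 3 3 (?g w u v 1)) = mat 3 3 (?g (f w) (f u) (f v) (f 1))"
    by (intro eq_matI) (auto simp: less_3)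
  finally have "det (leading_block 3 (mat 3 3 (?g (f w) (f u) (f v) (f 1)))) \<in> pos_elems"
    unfolding positive_definite_iff_leading_blocks[OF A] by (elim conjE) (erule bspec, simp)
  hence "det (mat 3 3 (?g (f w) (f u) (f v) (f 1))) \<in> pos_elems"
    unfolding leading_block_full[OF A] .
  moreover have "det (mat 3 3 (?g (f w) (f u) (f v) (f 1))) = 0"
    using \<open>f u = f v\<close> by (simp add: det_mat_3 algebra_simps)
  ultimately show False by simp
qed

lemma scaled_field_hom_preserves_positivity:
  fixes \<sigma> :: "'a::field \<Rightarrow> 'a"
  assumes "field_hom \<sigma>" "c \<in> pos_elems"
  shows "preserves_positivity n (\<lambda>x. c * \<sigma> x)"
  unfolding preserves_positivity_def
proof (intro ballI impI)
  interpret field_hom \<sigma> by fact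
  let ?f = "\<lambda>x. c * \<sigma> x"
  have pos: "\<sigma> x \<in> pos_elems" if "x \<in> pos_elems" for x
    using that unfolding pos_elems_iff by (metis hom_power hom_0_iff)
  fix A :: "'a mat" assume A: "A \<in> carrier_mat n n" and PA: "positive_definite A"
  have fA: "map_mat ?f A \<in> carrier_mat n n" using A by simp
  show "positive_definite (map_mat ?f A)"
    unfolding positive_definite_iff_leading_blocks[OF fA]
  proof (intro conjI ballI)
    have "transpose_mat (map_mat ?f A) = map_mat ?f (transpose_mat A)"
      by (intro eq_matI) auto
    thus "transpose_mat (map_mat ?f A) = map_mat ?f A"
      using PA A by (simp add: positive_definite_iff_leading_blocks)
    fix k assume k: "k \<in> {1..n}"
    have "map_mat ?f (leading_block k A) = c \<cdot>\<^sub>m map_mat \<sigma> (leading_block k A)"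
      by (intro eq_matI) auto
    moreover have "det (leading_block k A) \<in> pos_elems"
      using PA A k by (auto simp: positive_definite_iff_leading_blocks)
    ultimately show "det (leading_block k (map_mat ?f A)) \<in> pos_elems"
      using k assms(2) pos by (simp add: leading_block_map_mat[OF A] pos_elems_mult pos_elems_power)
  qed
qed

section \<open>Injective preservers of positivity of binary matrices\<close>

context paley_field begin

lemma binary_preserver_pos:
  fixes f :: "'a \<Rightarrow> 'a"
  assumes "preserves_binary_positivity f" "a \<in> P"
  shows "f a \<in> P"
  using assms unfolding preserves_binary_positivity_def
  by (metis diff_zero mult.right_neutral power_zero_numeral)

text \<open>
  From the matrix with rows \<open>a, a\<close> and \<open>a, c\<close>, of determinant \<open>a(c - a)\<close>: adjacency is preserved as soon
  as one of the two vertices lies in \<open>P\<close>.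
\<close>

lemma binary_preserver_edge:
  fixes f :: "'a \<Rightarrow> 'a"
  assumes "preserves_binary_positivity f" "a \<in> P" "c - a \<in> P"
  shows "f c - f a \<in> P"
proof -
  have "a * c - a ^ 2 \<in> P"
    using pos_elems_mult[OF assms(2,3)] by (simp add: power2_eq_square algebra_simps)
  hence "f a * f c - f a ^ 2 \<in> P"
    using assms unfolding preserves_binary_positivity_def by blast
  hence "f a * (f c - f a) \<in> P" by (simp add: power2_eq_square algebra_simps)
  thus ?thesis
    using pos_elems_mult_iff[OF binary_preserver_pos[OF assms(1,2)]] by simp
qed

text \<open>
  An injective map of a finite set into itself is onto, here applied to the set of triples \<open>(a, b, c)\<close>
  of entries of positive definite matrices.
\<close>

lemma injective_binary_preserver_iff:
  fixes f :: "'a \<Rightarrow> 'a"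
  assumes f: "preserves_binary_positivity f" and "inj f"
  shows "f a \<in> P \<and> f a * f c - f b ^ 2 \<in> P \<longleftrightarrow> a \<in> P \<and> a * c - b ^ 2 \<in> P"
proof -
  define T where "T = {(a, b, c). a \<in> P \<and> a * c - b ^ 2 \<in> P}"
  define F where "F = (\<lambda>(a, b, c). (f a, f b, f c))"
  have "F ` T \<subseteq> T"
    using f unfolding preserves_binary_positivity_def T_def F_def by auto
  moreover have inj: "inj F" using \<open>inj f\<close> by (auto simp: inj_def F_def)
  ultimately have "F ` T = T"
    by (intro endo_inj_surj inj_on_subset[OF inj]) auto
  hence "F (a, b, c) \<in> T \<longleftrightarrow> (a, b, c) \<in> T"
    using inj_image_mem_iff[OF inj, of "(a, b, c)" T] by simp
  thus ?thesis by (simp add: F_def T_def)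
qed

text \<open>
  The translate argument first gives \<open>f(0) = 0\<close> and \<open>f(b\<^sup>2/a) f(a) = f(b)\<^sup>2\<close>, that is, multiplicativity of
  \<open>f/f(1)\<close> on \<open>P\<close>. Differences with an entry in \<open>P\<close> are then under control, and a difference \<open>bs - b\<close> of
  two nonsquares is brought into this form by taking out the factor \<open>b\<close>.
\<close>

theorem injective_binary_preserver_quad_char:
  fixes f :: "'a \<Rightarrow> 'a"
  assumes f: "preserves_binary_positivity f" and "inj f"
  shows "f 0 = 0 \<and> (\<forall>a b. quad_char (f a - f b) = quad_char (a - b))"
proof -
  note iff = injective_binary_preserver_iff[OF f \<open>inj f\<close>]
  have surj: "\<exists>c. x = f c" for x
    using finite_UNIV_inj_surj[OF _ \<open>inj f\<close>] by (metis finite surj_def)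
  have fP: "f a \<in> P \<longleftrightarrow> a \<in> P" for a
  proof -
    have "f ` P = P"
      using binary_preserver_pos[OF f] by (intro endo_inj_surj inj_on_subset[OF \<open>inj f\<close>]) auto
    thus ?thesis using inj_image_mem_iff[OF \<open>inj f\<close>, of a P] by simp
  qed
  have edge: "f c - f a \<in> P \<longleftrightarrow> c - a \<in> P" if "a \<in> P" for a c
  proof -
    have "f a * f c - f a ^ 2 = f a * (f c - f a)" "a * c - a ^ 2 = a * (c - a)"
      by (simp_all add: power2_eq_square algebra_simps)
    thus ?thesis using iff[of a c a] that fP pos_elems_mult_iff by metis
  qed
  have f0: "f 0 = 0"
  proof -
    \<comment> \<open>All of \<open>P = f(P)\<close> is adjacent to \<open>f(0)\<close>, so \<open>P\<close> is the neighbourhood of \<open>f(0)\<close> as well as of \<open>0\<close>.\<close>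
    have "P \<subseteq> {x. x - f 0 \<in> P}"
    proof
      fix x assume "x \<in> P"
      then obtain a where "x = f a" "a \<in> P" using surj fP by metis
      thus "x \<in> {x. x - f 0 \<in> P}"
        using edge[of a 0] diff_pos_commute minus_pos_iff by simp
    qed
    hence "P = {x. x - f 0 \<in> P}"
      by (intro card_subset_eq) (auto simp: card_translate card_pos_elems)
    thus ?thesis using translates_of_pos_elems_distinct[of 0 "f 0"] by auto
  qed
  have mult: "f (b ^ 2 / a) * f a = f b ^ 2" if "a \<in> P" for a b
  proof (cases "b = 0")
    case False
    define d where "d = b ^ 2 / a"
    have "d \<in> P" unfolding d_def by (intro pos_elems_divide square_in_pos_elems False that)
    have "a \<noteq> 0" "f a \<noteq> 0" using that fP[of a] by auto
    \<comment> \<open>Both vertices have the neighbours \<open>f(c)\<close> with \<open>c\<close> adjacent to \<open>d\<close>.\<close>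
    have "x - f d \<in> P \<longleftrightarrow> x - f b ^ 2 / f a \<in> P" for x
    proof -
      obtain c where x: "x = f c" using surj by blast
      have "f a * f c - f b ^ 2 = f a * (f c - f b ^ 2 / f a)" "a * c - b ^ 2 = a * (c - d)"
        using \<open>a \<noteq> 0\<close> \<open>f a \<noteq> 0\<close> by (simp_all add: d_def field_simps)
      thus ?thesis
        using iff[of a c b] that fP[of a] edge[OF \<open>d \<in> P\<close>, of c] pos_elems_mult_iff x by metis
    qed
    hence "f d = f b ^ 2 / f a" by (rule translates_of_pos_elems_distinct)
    thus ?thesis using \<open>f a \<noteq> 0\<close> by (simp add: d_def)
  qed (simp add: f0)
  have f1: "f 1 \<in> P" using fP by simp
  hence "f 1 \<noteq> 0" by auto
  have ratio: "f (t / s) = f t * f 1 / f s" if t: "t \<in> P" and s: "s \<in> P" for s t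
  proof -
    obtain y where y: "t = y ^ 2" using t by (auto simp: pos_elems_iff)
    have "f (t / s) * f s = f t * f 1"
      using mult[OF s, of y] mult[of 1 y] y by simp
    moreover have "f s \<noteq> 0" using s fP[of s] by auto
    ultimately show ?thesis by (simp add: eq_divide_eq)
  qed
  have nonsquare: "f (c * s) = f c * f s / f 1" if c: "c \<notin> P" "c \<noteq> 0" and s: "s \<in> P" for c s
  proof (rule nonpos_determined_by_pos_neighbours)
    have fs: "f s \<in> P" using s fP by simp
    hence "f s \<noteq> 0" "s \<noteq> 0" using s by auto
    show "f (c * s) \<notin> P"
      using fP c(1) pos_elems_mult_iff[OF s, of c] by (simp add: mult.commute)
    have "f s / f 1 \<in> P" using fs f1 by (rule pos_elems_divide)
    thus "f c * f s / f 1 \<notin> P"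
      using pos_elems_mult_iff[of "f s / f 1" "f c"] fP c(1) by (simp add: mult.commute)
    fix x assume "x \<in> P"
    then obtain t where t: "x = f t" "t \<in> P" using surj fP by metis
    have "x - f (c * s) \<in> P \<longleftrightarrow> c * s - t \<in> P"
      using edge[OF t(2)] t(1) diff_pos_commute by metis
    also have "c * s - t = s * (c - t / s)" using \<open>s \<noteq> 0\<close> by (simp add: field_simps)
    also have "\<dots> \<in> P \<longleftrightarrow> c - t / s \<in> P" by (rule pos_elems_mult_iff[OF s])
    also have "\<dots> \<longleftrightarrow> f c - f (t / s) \<in> P"
      using edge[of "t / s" c] pos_elems_divide[OF t(2) s] by simp
    also have "\<dots> \<longleftrightarrow> (f s / f 1) * (f c - f (t / s)) \<in> P"
      using pos_elems_mult_iff[OF \<open>f s / f 1 \<in> P\<close>] by simp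
    also have "(f s / f 1) * (f c - f (t / s)) = f c * f s / f 1 - x"
      using \<open>f s \<noteq> 0\<close> \<open>f 1 \<noteq> 0\<close> by (simp add: ratio[OF t(2) s] t(1) field_simps)
    also have "\<dots> \<in> P \<longleftrightarrow> x - f c * f s / f 1 \<in> P" by (rule diff_pos_commute)
    finally show "x - f (c * s) \<in> P \<longleftrightarrow> x - f c * f s / f 1 \<in> P" .
  qed
  have "f a - f b \<in> P \<longleftrightarrow> a - b \<in> P" for a b
  proof -
    consider "a \<in> P" | "b \<in> P" | "a = 0" | "b = 0" | "a \<notin> P" "a \<noteq> 0" "b \<notin> P" "b \<noteq> 0"
      by blast
    thus ?thesis
    proof cases
      case 1
      thus ?thesis using edge[of a b] diff_pos_commute by metis
    next
      case 2
      thus ?thesis by (rule edge)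
    next
      case 5
      define s where "s = a / b"
      have s: "s \<in> P" "a = b * s" using 5 nonsquare_divide[of a b] by (auto simp: s_def)
      have "f b \<noteq> 0" using 5(4) f0 \<open>inj f\<close> by (metis injD)
      have fb: "f b / f 1 \<notin> P"
        using pos_elems_mult[OF _ f1, of "f b / f 1"] 5(3) fP[of b] \<open>f 1 \<noteq> 0\<close> by auto
      have "f a - f b = (f b / f 1) * (f s - f 1)"
        using nonsquare[OF 5(3,4) s(1)] s(2) \<open>f 1 \<noteq> 0\<close> by (simp add: field_simps)
      hence "f a - f b \<in> P \<longleftrightarrow> f s - f 1 \<noteq> 0 \<and> f s - f 1 \<notin> P"
        using nonsquare_mult_iff[OF fb] \<open>f b \<noteq> 0\<close> \<open>f 1 \<noteq> 0\<close> by simp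
      also have "\<dots> \<longleftrightarrow> s - 1 \<noteq> 0 \<and> s - 1 \<notin> P"
        using edge[of 1 s] injD[OF \<open>inj f\<close>, of s 1] by auto
      also have "\<dots> \<longleftrightarrow> b * (s - 1) \<in> P"
        using nonsquare_mult_iff[OF 5(3,4)] by simp
      also have "b * (s - 1) = a - b" using s(2) by (simp add: algebra_simps)
      finally show ?thesis .
    qed (simp_all add: f0 fP minus_pos_iff)
  qed
  thus ?thesis
    using f0 injD[OF \<open>inj f\<close>] by (auto intro!: quad_char_eqI)
qed

end

section \<open>Cliques of square-root size and fields of square order\<close>

context paley_field begin

lemma sum_quad_char: "(\<Sum>x::'a\<in>UNIV. quad_char x) = 0"
proof -
  have "(UNIV :: 'a set) = insert 0 (P \<union> (- P - {0}))" by auto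
  hence "(\<Sum>x::'a\<in>UNIV. quad_char x) = (\<Sum>x\<in>P. quad_char x) + (\<Sum>x\<in>- P - {0}. quad_char x)"
    by (metis (no_types, lifting) Diff_iff Un_iff ComplD add_0 disjoint_iff finite insertI1 quad_char_zero sum.insert sum.union_disjoint zero_notin_pos_elems)
  also have "(\<Sum>x\<in>P. quad_char x) = (\<Sum>x\<in>P. 1)"
    by (intro sum.cong) (auto simp: quad_char_def)
  also have "(\<Sum>x\<in>- P - {0}. quad_char x) = (\<Sum>x\<in>- P - {0 :: 'a}. - 1)"
    by (intro sum.cong) (auto simp: quad_char_def neg_elems_def)
  also have "- P - {0 :: 'a} = UNIV - insert 0 P" by auto
  hence "card (- P - {0 :: 'a}) = m"
    by (simp add: card_Diff_subset card_field card_pos_elems)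
  hence "(\<Sum>x\<in>- P - {0 :: 'a}. - 1) = - int m" by simp
  finally show ?thesis by (simp add: card_pos_elems)
qed

lemma sum_quad_char_shift: "(\<Sum>v\<in>UNIV. quad_char (v - c :: 'a)) = 0"
proof -
  have "(\<Sum>v\<in>UNIV. quad_char (v - c)) = (\<Sum>x::'a\<in>UNIV. quad_char x)"
    by (rule sum.reindex_bij_witness[of _ "\<lambda>x. x + c" "\<lambda>v. v - c"]) auto
  thus ?thesis by (simp add: sum_quad_char)
qed

lemma sum_quad_char_square: "(\<Sum>v\<in>UNIV. quad_char (v - c :: 'a) * quad_char (v - c)) = 2 * int m"
proof -
  have "(\<Sum>v\<in>UNIV. quad_char (v - c) * quad_char (v - c)) = (\<Sum>v\<in>UNIV - {c}. 1)"
  proof (rule sum.mono_neutral_cong_right)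
    fix v assume "v \<in> UNIV - {c}"
    thus "quad_char (v - c) * quad_char (v - c) = 1"
      using quad_char_cases[of "v - c"] quad_char_eq_0_iff[of "v - c"] by auto
  qed auto
  thus ?thesis by (simp add: card_field card_Diff_singleton)
qed

text \<open>
  For \<open>v \<noteq> c\<close> the product is the character of \<open>(v - d)/(v - c) = 1 - (d - c)/(v - c)\<close>, and this quotient
  runs through all elements except \<open>1\<close>.
\<close>

lemma sum_quad_char_product:
  assumes "c \<noteq> (d :: 'a)"
  shows "(\<Sum>v\<in>UNIV. quad_char (v - c) * quad_char (v - d)) = - 1"
proof -
  have "(\<Sum>v\<in>UNIV. quad_char (v - c) * quad_char (v - d)) =
      (\<Sum>v\<in>UNIV - {c}. quad_char (1 - (d - c) / (v - c)))"
  proof (rule sum.mono_neutral_cong_right)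
    fix v assume v: "v \<in> UNIV - {c}"
    hence "(v - c) * (v - d) = (v - c) ^ 2 * (1 - (d - c) / (v - c))"
      by (simp add: field_simps power2_eq_square)
    moreover have "(v - c) ^ 2 \<in> P" using v by (intro square_in_pos_elems) auto
    ultimately show "quad_char (v - c) * quad_char (v - d) = quad_char (1 - (d - c) / (v - c))"
      by (simp add: quad_char_eq_1_iff flip: quad_char_mult) (simp add: quad_char_mult quad_char_eq_1_iff)
  qed auto
  also have "\<dots> = (\<Sum>x\<in>UNIV - {1}. quad_char (x :: 'a))"
    by (rule sum.reindex_bij_witness[of _ "\<lambda>x. c + (d - c) / (1 - x)" "\<lambda>v. 1 - (d - c) / (v - c)"])
      (use assms in \<open>auto simp: field_simps\<close>)
  also have "\<dots> = - 1"
    using sum_quad_char by (simp add: sum_diff1 quad_char_def)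
  finally show ?thesis .
qed

definition clique :: "'a set \<Rightarrow> bool" where
  "clique C \<longleftrightarrow> (\<forall>x\<in>C. \<forall>y\<in>C. x \<noteq> y \<longrightarrow> x - y \<in> P)"

text \<open>
  Let \<open>S(v)\<close> be the sum in question. The first two moments of \<open>S\<close> over the whole field are known, and
  \<open>S = r - 1\<close> on the clique. What remains for the \<open>r\<^sup>2 - r\<close> other vertices is just enough to make
  the sum of the squares \<open>(S(v) + 1)\<^sup>2\<close> over them equal to zero. In graph terms: an outside vertex
  has exactly \<open>(r - 1)/2\<close> neighbours in the clique.
\<close>

lemma sum_quad_char_maximum_clique:
  assumes C: "clique C" "card C = r" and r: "r ^ 2 = 2 * m + 1" and v: "v \<notin> C"
  shows "(\<Sum>c\<in>C. quad_char (v - c)) = - 1"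
proof -
  define S where "S v = (\<Sum>c\<in>C. quad_char (v - c))" for v :: 'a
  have inside: "S v = int r - 1" if "v \<in> C" for v
  proof -
    have "S v = (\<Sum>c\<in>C - {v}. 1)"
      unfolding S_def using C(1) that
      by (intro sum.mono_neutral_cong_right) (auto simp: clique_def quad_char_eq_1_iff)
    also have "\<dots> = int (card C - 1)" using that by (simp add: card_Diff_singleton)
    also have "\<dots> = int r - 1"
      using that C(2) card_gt_0_iff[of C] by auto
    finally show ?thesis .
  qed
  have first: "(\<Sum>v\<in>UNIV. S v) = 0"
    unfolding S_def by (subst sum.swap) (simp add: sum_quad_char_shift)
  have "(\<Sum>v\<in>UNIV. S v * S v) =
      (\<Sum>v\<in>UNIV. \<Sum>c\<in>C. \<Sum>d\<in>C. quad_char (v - c) * quad_char (v - d))"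
    unfolding S_def by (simp add: sum_product)
  also have "\<dots> = (\<Sum>c\<in>C. \<Sum>v\<in>UNIV. \<Sum>d\<in>C. quad_char (v - c) * quad_char (v - d))"
    by (rule sum.swap)
  also have "\<dots> = (\<Sum>c\<in>C. \<Sum>d\<in>C. \<Sum>v\<in>UNIV. quad_char (v - c) * quad_char (v - d))"
    by (rule sum.cong[OF refl sum.swap])
  also have "\<dots> = (\<Sum>c\<in>C. \<Sum>d\<in>C. if d = c then 2 * int m else - 1)"
    by (intro sum.cong refl) (auto simp: sum_quad_char_square sum_quad_char_product)
  also have "\<dots> = (\<Sum>c\<in>C. 2 * int m - (int r - 1))"
  proof (intro sum.cong refl)
    fix c assume "c \<in> C"
    hence "(\<Sum>d\<in>C. if d = c then 2 * int m else - 1) = 2 * int m + (\<Sum>d\<in>C - {c}. - 1)"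
      by (subst sum.remove[of _ c]) (auto intro!: sum.cong)
    also have "(\<Sum>d\<in>C - {c}. - 1) = - (int r - 1)"
      using \<open>c \<in> C\<close> C(2) card_gt_0_iff[of C] by (auto simp: card_Diff_singleton)
    finally show "(\<Sum>d\<in>C. if d = c then 2 * int m else - 1) = 2 * int m - (int r - 1)" by simp
  qed
  also have "\<dots> = int r * (2 * int m - (int r - 1))" by (simp add: C(2))
  finally have second: "(\<Sum>v\<in>UNIV. S v * S v) = int r * (2 * int m - (int r - 1))" .
  have q: "2 * int m = int r ^ 2 - 1"
    using r by (metis add_diff_cancel_right' of_nat_1 of_nat_add of_nat_mult of_nat_numeral of_nat_power)
  \<comment> \<open>With \<open>2m = r\<^sup>2 - 1\<close> the moments cancel against the contribution \<open>r * r\<^sup>2\<close> of the clique.\<close>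
  have split: "(\<Sum>v\<in>- C. g v) = (\<Sum>v\<in>UNIV. g v) - (\<Sum>v\<in>C. g v)" for g :: "'a \<Rightarrow> int"
    by (simp add: Compl_eq_Diff_UNIV sum_diff)
  have "(\<Sum>v\<in>- C. (S v + 1) ^ 2) =
      (\<Sum>v\<in>UNIV. (S v + 1) ^ 2) - (\<Sum>v\<in>C. (S v + 1) ^ 2)"
    by (rule split)
  also have "(\<Sum>v\<in>UNIV. (S v + 1) ^ 2) = (\<Sum>v\<in>UNIV. S v * S v) + 2 * (\<Sum>v\<in>UNIV. S v) + (2 * int m + 1)"
  proof -
    have "(S v + 1) ^ 2 = S v * S v + (2 * S v + 1)" for v
      by (simp add: power2_eq_square algebra_simps)
    thus ?thesis by (simp add: sum.distrib card_field flip: sum_distrib_left)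
  qed
  also have "(\<Sum>v\<in>C. (S v + 1) ^ 2) = int r * int r ^ 2"
    using inside C(2) by simp
  also have "(\<Sum>v\<in>UNIV. S v * S v) + 2 * (\<Sum>v\<in>UNIV. S v) + (2 * int m + 1) - int r * int r ^ 2 = 0"
    unfolding first second q by (simp add: algebra_simps power2_eq_square)
  finally have "(\<Sum>v\<in>- C. (S v + 1) ^ 2) = 0" .
  hence "\<forall>v\<in>- C. (S v + 1) ^ 2 = 0"
    by (subst (asm) sum_nonneg_eq_0_iff) auto
  hence "S v + 1 = 0" using v by simp
  thus ?thesis unfolding S_def by simp
qed

end

text \<open>
  The elements fixed by a power of the Frobenius map form a subfield; closure under differences makes
  it a clique once its nonzero elements are known to be squares.
\<close>

lemma Frobenius_fixed_diff:
  fixes x y :: "'a::finite_field"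
  assumes "r = CHAR('a) ^ e" "odd r" "x ^ r = x" "y ^ r = y"
  shows "(x - y) ^ r = x - y"
proof -
  have "(x + - y) ^ r = x ^ r + (- y) ^ r"
    by (rule freshmans_dream') (simp_all add: assms(1))
  also have "(- y) ^ r = - (y ^ r)" using assms(2) by simp
  finally show ?thesis unfolding assms(3,4) by simp
qed

text \<open>
  The size of the field is \<open>r\<^sup>2\<close>. That \<open>r\<close> is a power of the characteristic is what makes
  \<open>x \<mapsto> x\<^sup>r\<close> additive.
\<close>

locale paley_field_square = paley_field field_type m
  for field_type :: "'a::finite_field itself" and m :: nat +
  fixes r e :: nat
  assumes r_square: "r ^ 2 = 2 * m + 1" and r_power: "r = CHAR('a) ^ e"
begin

lemma odd_r: "odd r" and r_ge_3: "r \<ge> 3"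
proof -
  have "odd (r ^ 2)" unfolding r_square by simp
  thus "odd r" by simp
  moreover have "r \<noteq> 1" using r_square m_ge_2 by auto
  ultimately show "r \<ge> 3" by presburger
qed

definition K :: "'a set" where "K = {x. x ^ r = x}"

lemma K_insert: "K = insert 0 {x. x ^ (r - 1) = 1}"
proof -
  have "x ^ r = x * x ^ (r - 1)" for x :: 'a
    using r_ge_3 by (metis Suc_diff_1 less_le_trans power_Suc zero_less_numeral)
  thus ?thesis using r_ge_3 by (auto simp: K_def)
qed

lemma r_factors: "(r - 1) * (r + 1) = 2 * m"
  using r_square by (cases r) (auto simp: power2_eq_square)

lemma card_K: "card K = r"
proof -
  have "(0 :: 'a) \<notin> {x. x ^ (r - 1) = 1}" using r_ge_3 by (simp add: power_0_left)
  hence "card K = Suc (card {x :: 'a. x ^ (r - 1) = 1})" unfolding K_insert by simp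
  also have "\<dots> = Suc (r - 1)" by (simp only: card_roots_of_unity(1)[OF r_factors])
  finally show ?thesis using r_ge_3 by simp
qed

text \<open>
  A nonzero \<open>x \<in> K\<close> satisfies \<open>x^(r-1) = 1\<close>, and \<open>r - 1\<close> divides \<open>m = (r - 1)(r + 1)/2\<close> because \<open>r\<close> is
  odd; so Euler's criterion applies.
\<close>

lemma K_pos: "x \<in> K \<Longrightarrow> x \<noteq> 0 \<Longrightarrow> x \<in> P"
proof -
  assume "x \<in> K" "x \<noteq> 0"
  hence x: "x ^ (r - 1) = 1" by (auto simp: K_insert)
  obtain j where "r + 1 = 2 * j" using odd_r by (metis even_add odd_one evenE)
  hence "m = (r - 1) * j" using r_factors by simp
  thus "x \<in> P" using x by (simp add: Euler_criterion power_mult)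
qed

definition line :: "'a \<Rightarrow> 'a set" where "line s = (\<lambda>t. s * t) ` K"

lemma zero_in_line: "0 \<in> line s" and self_in_line: "s \<in> line s"
proof -
  have "0 \<in> K" "1 \<in> K" using r_ge_3 by (auto simp: K_def)
  thus "0 \<in> line s" "s \<in> line s" unfolding line_def by force+
qed

lemma line_pos: "s \<in> P \<Longrightarrow> x \<in> line s \<Longrightarrow> x \<noteq> 0 \<Longrightarrow> x \<in> P"
  using K_pos by (auto simp: line_def intro: pos_elems_mult)

lemma clique_line:
  assumes "s \<in> P"
  shows "clique (line s)"
  unfolding clique_def
proof (intro ballI impI)
  fix x y assume "x \<in> line s" "y \<in> line s" "x \<noteq> y"
  then obtain t u where *: "x = s * t" "y = s * u" "t \<in> K" "u \<in> K" "t \<noteq> u"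
    by (auto simp: line_def)
  have "t - u \<in> K"
    using Frobenius_fixed_diff[OF r_power odd_r] *(3,4) by (simp add: K_def)
  hence "t - u \<in> P" using K_pos *(5) by simp
  thus "x - y \<in> P" using pos_elems_mult[OF assms] * by (simp flip: right_diff_distrib)
qed

lemma card_line:
  assumes "s \<in> P"
  shows "card (line s) = r"
proof -
  have "s \<noteq> 0" using assms by auto
  hence "inj_on (\<lambda>t. s * t) K" by (auto intro: inj_onI)
  thus ?thesis by (simp add: line_def card_image card_K)
qed

text \<open>
  Otherwise the sum of the characters of \<open>v - d\<close> over \<open>d \<in> C\<close>, which is \<open>-1\<close>, would be at least
  \<open>(r - 1) - 1 > 0\<close>.
\<close>

lemma almost_adjacent_imp_in_clique:
  assumes C: "clique C" "card C = r" and c: "c \<in> C" and v: "\<And>d. d \<in> C \<Longrightarrow> d \<noteq> c \<Longrightarrow> v - d \<in> P"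
  shows "v \<in> C"
proof (rule ccontr)
  assume "v \<notin> C"
  hence "(\<Sum>d\<in>C. quad_char (v - d)) = - 1"
    by (rule sum_quad_char_maximum_clique[OF C r_square])
  moreover have "(\<Sum>d\<in>C. quad_char (v - d)) = quad_char (v - c) + (\<Sum>d\<in>C - {c}. quad_char (v - d))"
    using c by (intro sum.remove) auto
  moreover have "(\<Sum>d\<in>C - {c}. quad_char (v - d)) = (\<Sum>d\<in>C - {c}. 1)"
    using v by (intro sum.cong) (auto simp: quad_char_eq_1_iff)
  moreover have "quad_char (v - c) \<ge> - 1"
    using quad_char_cases[of "v - c"] by auto
  ultimately show False using c C(2) r_ge_3 by (simp add: card_Diff_singleton)
qed

context
  fixes f :: "'a \<Rightarrow> 'a"
  assumes f: "preserves_binary_positivity f"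
begin

lemma line_image_edge:
  assumes "s \<in> P" "x \<in> line s" "y \<in> line s" "x \<noteq> y"
  shows "f x - f y \<in> P"
proof -
  have "x - y \<in> P" using clique_line[OF assms(1)] assms by (auto simp: clique_def)
  moreover have "x \<in> P \<or> y \<in> P" using line_pos[OF assms(1)] assms by metis
  ultimately show ?thesis
    using binary_preserver_edge[OF f] diff_pos_commute by metis
qed

lemma line_image:
  assumes "s \<in> P"
  shows "clique (f ` line s)" "card (f ` line s) = r" "inj_on f (line s)"
proof -
  show "clique (f ` line s)"
    using line_image_edge[OF assms] by (auto simp: clique_def)
  show inj: "inj_on f (line s)"
    using line_image_edge[OF assms] by (metis inj_onI cancel_comm_monoid_add_class.diff_cancel zero_notin_pos_elems)
  show "card (f ` line s) = r" using card_image[OF inj] card_line[OF assms] by simp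
qed

text \<open>
  Both \<open>0\<close> and \<open>f(0)\<close> are adjacent to all \<open>f(t)\<close> with \<open>t\<close> a nonzero element of \<open>K\<close>. Together with \<open>0\<close>
  these values form a clique of size \<open>r\<close>, so \<open>f(0)\<close> belongs to it; it is not one of the \<open>f(t)\<close>.
\<close>

lemma binary_preserver_zero: "f 0 = 0"
proof (rule ccontr)
  assume nz: "f 0 \<noteq> 0"
  define C where "C = insert 0 (f ` (line 1 - {0}))"
  have pos: "f t \<in> P" if "t \<in> line 1 - {0}" for t
    using that line_pos[of 1 t] binary_preserver_pos[OF f] by simp
  have "clique C"
    using pos line_image(1)[of 1] minus_pos_iff by (auto simp: clique_def C_def)
  moreover have "card C = r"
  proof -
    have "card (f ` (line 1 - {0})) = r - 1"
      using inj_on_subset[OF line_image(3)[of 1], of "line 1 - {0}"] card_line[of 1] zero_in_line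
      by (simp add: card_image card_Diff_singleton)
    moreover have "0 \<notin> f ` (line 1 - {0})" using pos by force
    ultimately show ?thesis unfolding C_def using r_ge_3 by simp
  qed
  moreover have "f 0 - d \<in> P" if "d \<in> C" "d \<noteq> 0" for d
    using that line_image_edge[of 1 0] zero_in_line[of 1] by (auto simp: C_def)
  moreover have "0 \<in> C" by (simp add: C_def)
  ultimately have "f 0 \<in> C" using almost_adjacent_imp_in_clique[of C 0 "f 0"] by blast
  then obtain t where "t \<in> line 1 - {0}" "f 0 = f t" using nz by (auto simp: C_def)
  thus False using inj_onD[OF line_image(3)[of 1], of 0 t] zero_in_line by auto
qed

text \<open>
  Put \<open>d = b\<^sup>2/a\<close>. The matrices with rows \<open>a, b\<close> and \<open>b, c\<close>, for \<open>c \<noteq> d\<close> on the line through \<open>d\<close>, show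
  that \<open>f(b)\<^sup>2/f(a)\<close> is adjacent to all \<open>f(c)\<close>. It therefore lies in the image of this line, and the
  only value left for it is \<open>f(d)\<close>.
\<close>

lemma binary_preserver_square_quotient:
  assumes a: "a \<in> P"
  shows "f (b ^ 2 / a) * f a = f b ^ 2"
proof (cases "b = 0")
  case False
  define d where "d = b ^ 2 / a"
  have d: "d \<in> P" unfolding d_def by (intro pos_elems_divide square_in_pos_elems False a)
  have fa: "f a \<in> P" using binary_preserver_pos[OF f a] .
  have nz: "a \<noteq> 0" "f a \<noteq> 0" using a fa by auto
  have adj: "f c - f b ^ 2 / f a \<in> P" if c: "c \<in> line d" "c \<noteq> d" for c
  proof -
    have "c - d \<in> P"
      using clique_line[OF d] c self_in_line by (auto simp: clique_def)
    moreover have "a * (c - d) = a * c - b ^ 2"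
      using nz by (simp add: d_def right_diff_distrib)
    ultimately have "a * c - b ^ 2 \<in> P"
      using pos_elems_mult[OF a, of "c - d"] by simp
    hence "f a * f c - f b ^ 2 \<in> P"
      using f a unfolding preserves_binary_positivity_def by blast
    hence "f a * (f c - f b ^ 2 / f a) \<in> P" using nz by (simp add: right_diff_distrib)
    thus ?thesis using pos_elems_mult_iff[OF fa] by simp
  qed
  have "f b ^ 2 / f a \<in> f ` line d"
  proof (rule almost_adjacent_imp_in_clique[OF line_image(1,2)[OF d]])
    show "f d \<in> f ` line d" using self_in_line by simp
    fix y assume "y \<in> f ` line d" "y \<noteq> f d"
    thus "f b ^ 2 / f a - y \<in> P" using adj diff_pos_commute by fastforce
  qed
  then obtain c where "c \<in> line d" "f b ^ 2 / f a = f c" by auto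
  hence "f b ^ 2 / f a = f d" using adj[of c] by (cases "c = d") auto
  thus ?thesis using nz by (simp add: d_def field_simps)
qed (simp add: binary_preserver_zero)

lemma binary_preserver_quotient:
  assumes "s \<in> P" "a \<in> P"
  shows "f (s / a) * f a = f s * f 1"
proof -
  obtain y where "s = y ^ 2" using assms(1) by (auto simp: pos_elems_iff)
  thus ?thesis using binary_preserver_square_quotient[OF assms(2), of y] binary_preserver_square_quotient[of 1 y] by simp
qed

lemma binary_preserver_one: "f 1 \<in> P" "f 1 \<noteq> 0"
  using binary_preserver_pos[OF f one_in_pos_elems] by auto

text \<open>
  For a nonsquare \<open>u\<close> one has \<open>u\<^sup>m = -1\<close>, and with \<open>g = f/f(1)\<close> multiplicativity on squares gives
  \<open>g(-1) = g(u\<^sup>2)^(m/2) = g(u)\<^sup>m\<close>. As \<open>f\<close> is injective on \<open>K\<close>, which contains \<open>1\<close> and \<open>-1\<close>, the value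
  \<open>g(u)\<^sup>m\<close> is not \<open>1\<close>.
\<close>

lemma binary_preserver_nonsquare:
  assumes u: "u \<notin> P" "u \<noteq> 0"
  shows "f u \<notin> P" "f u \<noteq> 0"
proof -
  have u2: "u ^ 2 \<in> P" using u(2) by (rule square_in_pos_elems)
  have sq: "f (u ^ 2) * f 1 = f u ^ 2" using binary_preserver_square_quotient[of 1 u] by simp
  show "f u \<noteq> 0"
    using sq binary_preserver_one(2) binary_preserver_pos[OF f u2] by auto
  define g where "g x = f x / f 1" for x
  have "g (s ^ n) = g s ^ n" if "s \<in> P" for s n
  proof (induction n)
    case (Suc n)
    have "s \<noteq> 0" using that by auto
    hence "f (s * s ^ n) * f 1 = f s * f (s ^ n)"
      using binary_preserver_quotient[of "s * s ^ n" "s ^ n"] pos_elems_power[OF that] pos_elems_mult[OF that] that by auto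
    hence "g (s * s ^ n) = g s * g (s ^ n)" using binary_preserver_one(2) by (simp add: g_def field_simps)
    thus ?case using Suc by simp
  qed (use binary_preserver_one in \<open>simp add: g_def\<close>)
  from this[OF u2, of "m div 2"] have "g (u ^ m) = (g (u ^ 2)) ^ (m div 2)"
    using even_m by (simp flip: power_mult)
  also have "g (u ^ 2) = g u ^ 2"
    using sq binary_preserver_one(2) by (simp add: g_def field_simps power2_eq_square)
  finally have "g (- 1) = g u ^ m"
    using even_m power_m_nonsquare[OF u(2,1)] by (simp flip: power_mult)
  moreover have "f (- 1) \<noteq> f 1"
  proof -
    have "- 1 \<in> line 1" using odd_r by (simp add: line_def K_def)
    moreover have "(- 1 :: 'a) \<noteq> 1" using two_nonzero by (metis add_neg_numeral_special(7) one_add_one)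
    ultimately show ?thesis
      using inj_onD[OF line_image(3)[OF one_in_pos_elems], of "- 1" 1] self_in_line[of 1] by blast
  qed
  ultimately have "g u ^ m \<noteq> 1" using binary_preserver_one(2) by (auto simp: g_def)
  hence "g u \<notin> P" by (simp add: Euler_criterion)
  thus "f u \<notin> P" using pos_elems_divide[OF _ binary_preserver_one(1)] by (auto simp: g_def)
qed

text \<open>
  The line through \<open>t\<close> and its image are cliques of size \<open>r\<close>, and they avoid \<open>u\<close> and \<open>f(u)\<close>
  respectively, both nonsquares. So the characters of \<open>u - c\<close> and of \<open>f(u) - f(c)\<close> have the same
  sum over the line, while the latter dominate the former term by term.
\<close>

lemma binary_preserver_nonsquare_edge:
  assumes u: "u \<notin> P" "u \<noteq> 0" and t: "t \<in> P"
  shows "f t - f u \<in> P \<longleftrightarrow> t - u \<in> P"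
proof -
  have le: "quad_char (u - c) \<le> quad_char (f u - f c)" if c: "c \<in> line t" for c
  proof (cases "u - c \<in> P")
    case True
    hence "c \<in> P" using u line_pos[OF t c] by (cases "c = 0") auto
    hence "f u - f c \<in> P" using binary_preserver_edge[OF f] True by blast
    thus ?thesis using True by (simp add: quad_char_eq_1_iff[THEN iffD2])
  next
    case False
    have "u \<noteq> c" using line_pos[OF t c] u by auto
    hence "quad_char (u - c) = - 1"
      using False quad_char_cases[of "u - c"] by (auto simp: quad_char_eq_1_iff quad_char_eq_0_iff)
    thus ?thesis using quad_char_cases[of "f u - f c"] by auto
  qed
  have "u \<notin> line t" using line_pos[OF t] u by auto
  hence 1: "(\<Sum>c\<in>line t. quad_char (u - c)) = - 1"
    by (rule sum_quad_char_maximum_clique[OF clique_line[OF t] card_line[OF t] r_square])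
  have "f u \<notin> f ` line t"
    using line_pos[OF t] binary_preserver_nonsquare[OF u] binary_preserver_zero binary_preserver_pos[OF f] by (metis imageE)
  hence "(\<Sum>c\<in>f ` line t. quad_char (f u - c)) = - 1"
    by (rule sum_quad_char_maximum_clique[OF line_image(1,2)[OF t] r_square])
  hence 2: "(\<Sum>c\<in>line t. quad_char (f u - f c)) = - 1"
    by (simp add: sum.reindex[OF line_image(3)[OF t]])
  have "quad_char (u - t) = quad_char (f u - f t)"
    by (rule sum_mono_inv[OF trans[OF 1 2[symmetric]] le self_in_line]) simp_all
  thus ?thesis
    using quad_char_eq_1_iff diff_pos_commute by metis
qed

text \<open>
  Two nonsquares with the same image have the same neighbours in \<open>P\<close>. Two squares \<open>x, y\<close> with the same
  image are compared through a nonsquare \<open>u\<close>: multiplicativity on \<open>P\<close> gives \<open>ux\<close> and \<open>uy\<close> the same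
  neighbours in \<open>P\<close>.
\<close>

theorem binary_preserver_inj: "inj f"
proof (rule injI)
  fix x y assume eq: "f x = f y"
  have zero: "f x = 0 \<longleftrightarrow> x = 0" for x
    using binary_preserver_zero binary_preserver_nonsquare binary_preserver_pos[OF f] zero_notin_pos_elems by metis
  have pos: "f x \<in> P \<longleftrightarrow> x \<in> P" for x
    using binary_preserver_zero binary_preserver_nonsquare binary_preserver_pos[OF f] zero_notin_pos_elems by metis
  consider "x = 0" "y = 0" | "x \<notin> P" "x \<noteq> 0" "y \<notin> P" "y \<noteq> 0" | "x \<in> P" "y \<in> P"
    using zero pos eq by metis
  thus "x = y"
  proof cases
    case 2
    thus ?thesis
      using binary_preserver_nonsquare_edge eq by (intro nonpos_determined_by_pos_neighbours) metis+
  next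
    case 3
    have "card P < card (UNIV - {0 :: 'a})"
      using m_ge_2 by (simp add: card_pos_elems card_field card_Diff_singleton)
    hence "\<not> UNIV - {0 :: 'a} \<subseteq> P" using card_mono[of P] by (metis finite leD)
    then obtain u :: 'a where u: "u \<noteq> 0" "u \<notin> P" by auto
    have nz: "z \<noteq> 0 \<and> f z \<noteq> 0" if "z \<in> P" for z using that zero by auto
    have scaled: "s - u * z \<in> P \<longleftrightarrow> f s * f 1 / f z - f u \<in> P" if "s \<in> P" "z \<in> P" for s z
    proof -
      have "s - u * z = z * (s / z - u)" using nz[OF that(2)] by (simp add: field_simps)
      hence "s - u * z \<in> P \<longleftrightarrow> s / z - u \<in> P" using pos_elems_mult_iff[OF that(2)] by simp
      also have "\<dots> \<longleftrightarrow> f (s / z) - f u \<in> P"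
        using binary_preserver_nonsquare_edge[OF u(2,1) pos_elems_divide[OF that]] by simp
      also have "f (s / z) = f s * f 1 / f z"
        using binary_preserver_quotient[OF that] nz[OF that(2)] by (simp add: field_simps)
      finally show ?thesis .
    qed
    have "u * z \<notin> P" if "z \<in> P" for z
      using pos_elems_mult_iff[OF that, of u] u by (simp add: mult.commute)
    hence "u * x = u * y"
      using 3 scaled eq by (intro nonpos_determined_by_pos_neighbours) auto
    thus ?thesis using u by simp
  qed simp
qed

end

end

section \<open>Maps preserving the quadratic character\<close>

text \<open>
  One digit of Lucas's congruence, read off from \<open>(1 + X)^(pa + b) = (1 + X\<^sup>p)\<^sup>a (1 + X)\<^sup>b\<close>. The bounds on
  \<open>b\<close> and \<open>d\<close> leave a single contribution to the coefficient of \<open>X^(pc + d)\<close>.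
\<close>

lemma Lucas_step:
  fixes p a b c d :: nat
  assumes p: "p = CHAR('a::comm_semiring_prime_char)" and "b < p" "d < p"
  shows "(of_nat ((p * a + b) choose (p * c + d)) :: 'a) = of_nat (a choose c) * of_nat (b choose d)"
proof -
  have coeff_binomial: "coeff ([:1, 1 :: 'a:] ^ n) i = of_nat (n choose i)" for n i
    by (cases "i \<le> n")
      (auto simp: coeff_linear_poly_power binomial_eq_0
        intro!: coeff_eq_0 le_less_trans[OF degree_power_le])
  have "[:1, 1 :: 'a:] = 1 + [:0, 1:]" by (simp add: one_pCons)
  hence "[:1, 1 :: 'a:] ^ p = 1 ^ p + [:0, 1:] ^ p"
    by (simp only:) (rule freshmans_dream, simp_all add: p)
  hence "[:1, 1 :: 'a:] ^ p = monom 1 p + 1" by (simp add: monom_altdef add.commute)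
  hence "[:1, 1 :: 'a:] ^ (p * a + b) = (monom 1 p + 1) ^ a * [:1, 1:] ^ b"
    by (simp add: power_add power_mult)
  also have "(monom 1 p + 1 :: 'a poly) ^ a = (\<Sum>i\<le>a. of_nat (a choose i) * monom 1 (p * i))"
    unfolding binomial_ring by (simp add: monom_power)
  finally have "of_nat ((p * a + b) choose (p * c + d)) =
      (\<Sum>i\<le>a. coeff (of_nat (a choose i) * (monom 1 (p * i) * [:1, 1 :: 'a:] ^ b)) (p * c + d))"
    by (simp add: sum_distrib_right coeff_sum mult.assoc flip: coeff_binomial)
  also have "\<dots> = (\<Sum>i\<le>a. if i = c then of_nat (a choose c) * of_nat (b choose d) else 0)"
  proof (intro sum.cong refl)
    fix i
    have "coeff (monom 1 (p * i) * [:1, 1 :: 'a:] ^ b) (p * c + d) =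
        (if i = c then of_nat (b choose d) else 0)"
    proof -
      consider "i = c" | "i < c" | "i > c" by linarith
      thus ?thesis
      proof cases
        case 2
        then obtain j where "c = i + 1 + j" by (metis add.assoc less_imp_Suc_add plus_1_eq_Suc add.commute)
        hence "p * c + d - p * i > b" using \<open>b < p\<close> by (simp add: algebra_simps)
        thus ?thesis using 2 by (simp add: coeff_monom_mult coeff_binomial binomial_eq_0)
      next
        case 3
        then obtain j where "i = c + 1 + j" by (metis add.assoc less_imp_Suc_add plus_1_eq_Suc add.commute)
        hence "\<not> p * i \<le> p * c + d" using \<open>d < p\<close> by (simp add: algebra_simps)
        thus ?thesis using 3 by (simp add: coeff_monom_mult)
      qed (simp add: coeff_monom_mult coeff_binomial)
    qed
    thus "coeff (of_nat (a choose i) * (monom 1 (p * i) * [:1, 1 :: 'a:] ^ b)) (p * c + d) =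
        (if i = c then of_nat (a choose c) * of_nat (b choose d) else 0)"
      by (simp add: of_nat_poly)
  qed
  also have "\<dots> = of_nat (a choose c) * of_nat (b choose d)"
    by (simp add: binomial_eq_0)
  finally show ?thesis .
qed

context paley_field begin

text \<open>
  If \<open>2m\<close> does not divide \<open>i\<close>, some nonzero \<open>z\<close> has \<open>z\<^sup>i \<noteq> 1\<close>, and substituting \<open>zx\<close> for \<open>x\<close> multiplies
  the sum by \<open>z\<^sup>i\<close>.
\<close>

lemma sum_of_powers:
  "(\<Sum>x::'a\<in>UNIV. x ^ i) = (if i > 0 \<and> 2 * m dvd i then - 1 else 0)"
proof -
  consider "i = 0" | "i > 0" "2 * m dvd i" | "\<not> 2 * m dvd i" by auto
  thus ?thesis
  proof cases
    case 1
    thus ?thesis using two_m by (simp add: card_field)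
  next
    case 2
    then obtain j where j: "i = 2 * m * j" by auto
    have "(\<Sum>x::'a\<in>UNIV. x ^ i) = (\<Sum>x::'a\<in>UNIV - {0}. 1)"
    proof (rule sum.mono_neutral_cong_right)
      fix x :: 'a assume "x \<in> UNIV - {0}"
      thus "x ^ i = 1" unfolding j power_mult[of x "2 * m"] by (simp add: power_two_m)
    qed (use 2 in auto)
    thus ?thesis using 2 two_m by (simp add: card_field card_Diff_singleton)
  next
    case 3
    define j where "j = i mod (2 * m)"
    have j: "0 < j" "j < 2 * m" using 3 m_ge_2 by (auto simp: j_def mod_greater_zero_iff_not_dvd)
    have "card {x :: 'a. x ^ j = 1} < card (UNIV - {0 :: 'a})"
      using card_power_fibre_le[OF j(1), of 1] j(2) by (simp add: card_field card_Diff_singleton)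
    hence "\<not> UNIV - {0 :: 'a} \<subseteq> {x. x ^ j = 1}"
      using card_mono[of "{x :: 'a. x ^ j = 1}"] by (metis finite leD)
    then obtain z :: 'a where z: "z \<noteq> 0" "z ^ j \<noteq> 1" by auto
    have "z ^ i = z ^ (2 * m * (i div (2 * m)) + j)" by (simp add: j_def)
    also have "\<dots> = z ^ j" using z(1) by (simp add: power_add power_mult[of z "2 * m"] power_two_m)
    finally have "z ^ i \<noteq> 1" using z(2) by simp
    have "(\<Sum>x\<in>UNIV. x ^ i) = (\<Sum>x\<in>UNIV. (z * x) ^ i)"
      by (rule sum.reindex_bij_witness[of _ "\<lambda>x. z * x" "\<lambda>x. x / z"]) (use z in auto)
    also have "\<dots> = z ^ i * (\<Sum>x\<in>UNIV. x ^ i)"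
      by (simp add: power_mult_distrib sum_distrib_left)
    finally have "(\<Sum>x::'a\<in>UNIV. x ^ i) = 0" using \<open>z ^ i \<noteq> 1\<close> by auto
    thus ?thesis using 3 by simp
  qed
qed

text \<open>
  Expressing coefficients by values lets identities between functions be turned into identities
  between coefficients.
\<close>

lemma coeff_via_sum:
  assumes "degree G < 2 * m" "j < 2 * m"
  shows "coeff G j = - (\<Sum>x::'a\<in>UNIV. poly G x * x ^ (2 * m - j))"
proof -
  have "(\<Sum>x\<in>UNIV. poly G x * x ^ (2 * m - j)) =
      (\<Sum>x\<in>UNIV. \<Sum>i\<le>degree G. coeff G i * x ^ (i + (2 * m - j)))"
    by (simp add: poly_altdef sum_distrib_right power_add mult.assoc)
  also have "\<dots> = (\<Sum>i\<le>degree G. coeff G i * (\<Sum>x\<in>UNIV. x ^ (i + (2 * m - j))))"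
    by (subst sum.swap) (simp add: sum_distrib_left)
  also have "\<dots> = (\<Sum>i\<le>degree G. if i = j then - coeff G j else 0)"
  proof (intro sum.cong refl)
    fix i assume i: "i \<in> {..degree G}"
    have "2 * m dvd i + (2 * m - j) \<longleftrightarrow> i = j"
    proof
      assume "2 * m dvd i + (2 * m - j)"
      then obtain w where w: "i + (2 * m - j) = 2 * m * w" by auto
      have "0 < i + (2 * m - j)" "i + (2 * m - j) < 2 * m * 2" using i assms by auto
      hence "0 < 2 * m * w" "2 * m * w < 2 * m * 2" unfolding w .
      hence "w = 1" by simp
      thus "i = j" using w assms(2) by simp
    qed (use assms in simp)
    thus "coeff G i * (\<Sum>x\<in>UNIV. x ^ (i + (2 * m - j))) = (if i = j then - coeff G j else 0)"
      using assms(2) by (simp add: sum_of_powers)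
  qed
  also have "\<dots> = - coeff G j" by (simp add: coeff_eq_0)
  finally show ?thesis by simp
qed

definition spanned :: "('a \<Rightarrow> 'a) \<Rightarrow> bool" where
  "spanned g \<longleftrightarrow> (\<exists>c. \<forall>x. g x = (\<Sum>y\<in>UNIV. c y * (x - y) ^ m))"

lemma spanned_degree:
  assumes "spanned g"
  shows "\<exists>G. degree G \<le> m \<and> (\<forall>x. poly G x = g x)"
proof -
  obtain c where c: "\<And>x. g x = (\<Sum>y\<in>UNIV. c y * (x - y) ^ m)"
    using assms unfolding spanned_def by blast
  define G where "G = (\<Sum>y\<in>UNIV. smult (c y) ([:- y, 1:] ^ m))"
  have "degree G \<le> m" unfolding G_def
    by (intro degree_sum_le order_trans[OF degree_smult_le] order_trans[OF degree_power_le]) auto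
  moreover have "poly G x = g x" for x
    by (simp add: G_def c poly_sum)
  ultimately show ?thesis by blast
qed

text \<open>
  The combination of the functions \<open>(x - y)\<^sup>m\<close> with weights \<open>y^(m+t)\<close> sorts out one term of the binomial
  expansion: the power sum over \<open>y\<close> vanishes unless the total exponent of \<open>y\<close> is \<open>2m\<close>.
\<close>

lemma spanned_monomial:
  assumes "(of_nat (m choose t) :: 'a) \<noteq> 0"
  shows "spanned (\<lambda>x. x ^ t)"
proof -
  have t: "t \<le> m" using assms by (rule contrapos_np) (simp add: binomial_eq_0)
  define b :: 'a where "b = - (of_nat (m choose t) * (- 1) ^ (m - t))"
  have "b \<noteq> 0" using assms by (simp add: b_def)
  have "(\<Sum>y\<in>UNIV. y ^ (m + t) * (x - y) ^ m) = b * x ^ t" for x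
  proof -
    have "(x - y) ^ m = (\<Sum>j\<le>m. of_nat (m choose j) * x ^ j * ((- 1) ^ (m - j) * y ^ (m - j)))" for y
      using binomial_ring[of x "- y" m] by (simp flip: power_mult_distrib)
    hence "(\<Sum>y\<in>UNIV. y ^ (m + t) * (x - y) ^ m) =
        (\<Sum>y\<in>UNIV. \<Sum>j\<le>m. of_nat (m choose j) * x ^ j * (- 1) ^ (m - j) * y ^ (m + t + (m - j)))"
      by (simp only: sum_distrib_left power_add mult.assoc mult.commute mult.left_commute)
    also have "\<dots> = (\<Sum>j\<le>m. of_nat (m choose j) * x ^ j * (- 1) ^ (m - j) * (\<Sum>y\<in>UNIV. y ^ (m + t + (m - j))))"
      by (subst sum.swap) (simp add: sum_distrib_left)
    also have "\<dots> = (\<Sum>j\<le>m. if j = t then b * x ^ t else 0)"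
    proof (intro sum.cong refl)
      fix j assume j: "j \<in> {..m}"
      have "2 * m dvd m + t + (m - j) \<longleftrightarrow> j = t"
      proof
        assume "2 * m dvd m + t + (m - j)"
        then obtain w where w: "m + t + (m - j) = 2 * m * w" by auto
        have "0 < m + t + (m - j)" "m + t + (m - j) < 2 * m * 2" using j t m_ge_2 by auto
        hence "0 < 2 * m * w" "2 * m * w < 2 * m * 2" unfolding w .
        hence "w = 1" by simp
        thus "j = t" using w j by simp
      qed (use t in \<open>simp flip: mult_2\<close>)
      thus "of_nat (m choose j) * x ^ j * (- 1) ^ (m - j) * (\<Sum>y\<in>UNIV. y ^ (m + t + (m - j))) =
          (if j = t then b * x ^ t else 0)"
        using m_ge_2 by (simp add: sum_of_powers b_def)
    qed
    also have "\<dots> = b * x ^ t" using t by simp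
    finally show ?thesis .
  qed
  hence "x ^ t = (\<Sum>y\<in>UNIV. y ^ (m + t) / b * (x - y) ^ m)" for x
    using \<open>b \<noteq> 0\<close> by (simp flip: sum_divide_distrib)
  thus ?thesis unfolding spanned_def by (intro exI[of _ "\<lambda>y. y ^ (m + t) / b"]) simp
qed

lemma odd_CHAR: "odd CHAR('a)"
proof
  assume "even CHAR('a)"
  hence "CHAR('a) = 2" using CHAR_prime[where ?'a = 'a] by (metis prime_nat_iff even_numeral dvd_refl primes_dvd_imp_eq two_is_prime_nat)
  thus False using two_nonzero of_nat_CHAR[where ?'a = 'a] by simp
qed

lemma character_power_odd:
  assumes "odd n"
  shows "(z ^ m) ^ n = (z :: 'a) ^ m"
proof -
  have "z ^ m = 0 \<or> z ^ m = 1 \<or> z ^ m = - 1"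
    using m_ge_2 Euler_criterion[of z] power_m_nonsquare[of z] by (cases "z = 0") auto
  thus ?thesis using assms odd_pos[OF assms] by (auto simp: power_0_left)
qed

text \<open>
  The values of \<open>(x - y)\<^sup>m\<close> are \<open>0\<close>, \<open>1\<close> and \<open>-1\<close>, which the Frobenius map fixes.
\<close>

lemma spanned_Frobenius:
  assumes "spanned g"
  shows "spanned (\<lambda>x. g x ^ CHAR('a) ^ s)"
proof -
  obtain c where c: "\<And>x. g x = (\<Sum>y\<in>UNIV. c y * (x - y) ^ m)"
    using assms unfolding spanned_def by blast
  have "g x ^ CHAR('a) ^ s = (\<Sum>y\<in>UNIV. c y ^ CHAR('a) ^ s * (x - y) ^ m)" for x
    unfolding c using odd_CHAR
    by (subst freshmans_dream_sum') (simp_all add: power_mult_distrib character_power_odd)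
  thus ?thesis unfolding spanned_def by (intro exI[of _ "\<lambda>y. c y ^ CHAR('a) ^ s"]) simp
qed

text \<open>
  Composition with \<open>f\<close> merely permutes the spanning functions, because \<open>(f(x) - f(y))\<^sup>m = (x - y)\<^sup>m\<close>
  and \<open>f\<close> is bijective.
\<close>

lemma spanned_compose:
  fixes f :: "'a \<Rightarrow> 'a"
  assumes "spanned g" and f: "\<And>a b. quad_char (f a - f b) = quad_char (a - b)"
  shows "spanned (\<lambda>x. g (f x))"
proof -
  obtain c where c: "\<And>x. g x = (\<Sum>y\<in>UNIV. c y * (x - y) ^ m)"
    using assms(1) unfolding spanned_def by blast
  have "inj f"
    using f by (intro injI) (metis cancel_comm_monoid_add_class.diff_cancel eq_iff_diff_eq_0 quad_char_eq_0_iff)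
  hence bij: "bij f" using finite_UNIV_inj_surj[of f] by (simp add: bij_def)
  have f': "(f a - f b) ^ m = (a - b) ^ m" for a b
    using f[of a b] of_int_quad_char by metis
  have "g (f x) = (\<Sum>y\<in>UNIV. c (f y) * (x - y) ^ m)" for x
  proof -
    have "g (f x) = (\<Sum>y\<in>UNIV. c (f y) * (f x - f y) ^ m)"
      unfolding c by (rule sum.reindex_bij_betw[OF bij, symmetric])
    thus ?thesis by (simp add: f')
  qed
  thus ?thesis unfolding spanned_def by (intro exI[of _ "\<lambda>y. c (f y)"]) simp
qed

lemma poly_eq_if_eq_fun:
  assumes "degree F \<le> 2 * m" "degree G \<le> 2 * m" "\<And>x :: 'a. poly F x = poly G x"
  shows "F = G"
  using assms by (intro poly_eqI_degree[of UNIV]) (auto simp: card_field)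

end

locale paley_field_power = paley_field field_type m
  for field_type :: "'a::finite_field itself" and m :: nat +
  fixes p k h :: nat
  assumes p_CHAR: "p = CHAR('a)" and p_power: "p ^ k = 2 * m + 1" and p_eq: "p = 2 * h + 1"
begin

text \<open>
  The number written with \<open>n\<close> digits \<open>1\<close> in base \<open>p\<close>. Since \<open>m = h * repunit k\<close>, all \<open>k\<close> digits of \<open>m\<close>
  are \<open>h = (p - 1)/2\<close>.
\<close>

definition repunit :: "nat \<Rightarrow> nat" where "repunit n = (\<Sum>i<n. p ^ i)"

lemma prime_p: "prime p" by (simp add: p_CHAR)

lemma h_pos: "h > 0" using prime_p p_eq by (auto intro: Nat.gr0I)

lemma repunit_Suc: "repunit (Suc n) = p * repunit n + 1"
  unfolding repunit_def sum.lessThan_Suc_shift by (simp add: sum_distrib_left)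

lemma repunit_eq: "2 * (h * repunit n) + 1 = p ^ n"
proof (induction n)
  case (Suc n)
  have "2 * (h * repunit (Suc n)) + 1 = p * (2 * (h * repunit n)) + (2 * h + 1)"
    by (simp add: repunit_Suc algebra_simps)
  also have "\<dots> = p * (2 * (h * repunit n) + 1)"
    using p_eq by (simp only: distrib_left mult_1_right)
  also have "\<dots> = p ^ Suc n" by (simp only: Suc power_Suc)
  finally show ?case .
qed (simp add: repunit_def)

lemma m_eq: "m = h * repunit k"
  using repunit_eq[of k] p_power by simp

lemma repunit_less: "k > 0 \<Longrightarrow> repunit k < 2 * p ^ (k - 1)"
proof -
  assume "k > 0"
  hence "p ^ k = p * p ^ (k - 1)" by (simp flip: power_Suc)
  hence *: "2 * h * repunit k < (2 * h + 1) * p ^ (k - 1)" using repunit_eq[of k] p_eq by simp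
  also have "\<dots> \<le> 2 * h * (2 * p ^ (k - 1))" using h_pos by (simp add: algebra_simps)
  finally show ?thesis by simp
qed

text \<open>
  By Lucas's congruence a binomial coefficient of \<open>m\<close> is nonzero modulo \<open>p\<close> when no digit of the lower
  argument exceeds \<open>h\<close>. The lower arguments here have one or two nonzero digits.
\<close>

lemma binomial_repunit_nonzero:
  shows "u \<le> h \<Longrightarrow> n > 0 \<Longrightarrow> (of_nat (h * repunit n choose u) :: 'a) \<noteq> 0"
    and "i < n \<Longrightarrow> (of_nat (h * repunit n choose (h * p ^ i)) :: 'a) \<noteq> 0"
    and "0 < i \<Longrightarrow> i < n \<Longrightarrow> (of_nat (h * repunit n choose (h + h * p ^ i)) :: 'a) \<noteq> 0"
proof -
  have shift: "h * repunit (Suc n) = p * (h * repunit n) + h" for n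
    by (simp add: repunit_Suc algebra_simps)
  have hp: "h < p" using p_eq by simp
  show low: "(of_nat (h * repunit n choose u) :: 'a) \<noteq> 0" if u: "u \<le> h" and "n > 0" for u n
  proof -
    obtain n' where n: "n = Suc n'" using \<open>n > 0\<close> by (cases n) auto
    have "\<not> p dvd (h choose u)"
    proof
      assume "p dvd (h choose u)"
      hence "p dvd fact h"
        using binomial_fact_lemma[OF u] by (metis dvd_mult)
      thus False using prime_dvd_fact_iff[OF prime_p] hp by simp
    qed
    hence "(of_nat (h choose u) :: 'a) \<noteq> 0"
      by (simp add: of_nat_eq_0_iff_char_dvd p_CHAR)
    thus ?thesis
      using Lucas_step[where ?'a = 'a, OF p_CHAR hp, of u "h * repunit n'" 0] u hp
      by (simp add: n shift)
  qed
  show mid: "(of_nat (h * repunit n choose (h * p ^ i)) :: 'a) \<noteq> 0" if "i < n" for i n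
    using that
  proof (induction i arbitrary: n)
    case 0
    thus ?case using low[of h n] by simp
  next
    case (Suc i)
    then obtain n' where n: "n = Suc n'" "i < n'" by (cases n) auto
    have "(of_nat (h * repunit n choose (h * p ^ Suc i)) :: 'a) = of_nat (h * repunit n' choose (h * p ^ i))"
      using Lucas_step[where ?'a = 'a, OF p_CHAR hp, of 0 "h * repunit n'" "h * p ^ i"] hp
      by (simp add: n shift mult_ac)
    thus ?case using Suc.IH[OF n(2)] by simp
  qed
  show "(of_nat (h * repunit n choose (h + h * p ^ i)) :: 'a) \<noteq> 0" if i0: "0 < i" "i < n"
  proof -
    obtain i' where i: "i = Suc i'" using i0 by (cases i) auto
    obtain n' where n: "n = Suc n'" using i0 by (cases n) auto
    have less: "i' < n'" using i0 i n by simp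
    have "(of_nat (h * repunit n choose (h + h * p ^ i)) :: 'a) = of_nat (h * repunit n' choose (h * p ^ i'))"
      using Lucas_step[where ?'a = 'a, OF p_CHAR hp hp, of "h * repunit n'" "h * p ^ i'"]
      by (simp add: i n shift mult_ac add.commute[of h "h * (p * p ^ i')"])
    thus ?thesis using mid[OF less] by simp
  qed
qed

lemma k_pos: "k > 0"
  using p_power m_ge_2 by (auto intro: Nat.gr0I)

context
  fixes f :: "'a \<Rightarrow> 'a"
  assumes f0: "f 0 = 0" and f: "\<And>a b. quad_char (f a - f b) = quad_char (a - b)"
begin

lemma ex_low_degree_power:
  assumes "(of_nat (m choose t) :: 'a) \<noteq> 0"
  shows "\<exists>G. degree G \<le> m \<and> (\<forall>x. poly G x = f x ^ (t * p ^ r))"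
proof -
  have "spanned (\<lambda>x. (f x ^ t) ^ CHAR('a) ^ r)"
    using spanned_Frobenius[OF spanned_compose[OF spanned_monomial[OF assms] f]] .
  from spanned_degree[OF this] show ?thesis by (simp add: p_CHAR power_mult)
qed

text \<open>
  The choice is unique: polynomials of degree below \<open>q\<close> are determined by their values.
\<close>

definition twist :: "nat \<Rightarrow> 'a poly" where
  "twist r = (SOME G. degree G \<le> m \<and> (\<forall>x. poly G x = f x ^ p ^ r))"

lemma degree_twist_le_m: "degree (twist r) \<le> m"
  and poly_twist: "poly (twist r) x = f x ^ p ^ r"
proof -
  have "\<exists>G. degree G \<le> m \<and> (\<forall>x. poly G x = f x ^ p ^ r)"
    using ex_low_degree_power[of 1 r] of_nat_m_nonzero by simp
  from someI_ex[OF this] show "degree (twist r) \<le> m" "poly (twist r) x = f x ^ p ^ r"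
    unfolding twist_def by blast+
qed

lemma quad_char_preserver_one_pos: "f 1 \<in> P"
  using f[of 1 0] f0 quad_char_eq_1_iff[of "f 1"] quad_char_eq_1_iff[of "1 :: 'a"] by simp

lemma twist_nonzero: "twist r \<noteq> 0"
proof
  assume "twist r = 0"
  hence "f 1 ^ p ^ r = 0" using poly_twist[of r 1] by simp
  thus False using quad_char_preserver_one_pos by auto
qed

text \<open>
  If the degree \<open>d\<close> exceeds \<open>repunit k\<close>, then \<open>m < hd\<close>, so the least \<open>u\<close> with \<open>ud > m\<close> is at most \<open>h\<close>, and
  \<open>ud \<le> m + d \<le> 2m\<close>. The \<open>u\<close>-th power of the polynomial thus still has degree below \<open>q\<close> and represents
  its function faithfully; but this function is given by a polynomial of degree at most \<open>m\<close>.
\<close>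

lemma degree_twist_le: "degree (twist r) \<le> repunit k"
proof (rule ccontr)
  define d where "d = degree (twist r)"
  assume "\<not> degree (twist r) \<le> repunit k"
  hence d: "d > repunit k" by (simp add: d_def)
  \<comment> \<open>The least \<open>u\<close> with \<open>m < ud\<close>.\<close>
  define u where "u = m div d + 1"
  have "m < h * d" unfolding m_eq using d h_pos by simp
  hence "u \<le> h" unfolding u_def using less_mult_imp_div_less[of m h d] by simp
  have ud: "m < u * d" unfolding u_def using d dividend_less_div_times[of d m] by (simp add: algebra_simps)
  have "u * d \<le> m + d" unfolding u_def by (simp add: algebra_simps)
  also have "\<dots> \<le> 2 * m" using degree_twist_le_m[of r] by (simp add: d_def)
  finally have ud': "u * d \<le> 2 * m" .
  have deg: "degree (twist r ^ u) = u * d"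
    by (simp add: degree_power_eq twist_nonzero d_def)
  obtain G where G: "degree G \<le> m" "\<And>x. poly G x = f x ^ (u * p ^ r)"
    using ex_low_degree_power[of u r] binomial_repunit_nonzero(1)[OF \<open>u \<le> h\<close> k_pos] by (auto simp: m_eq)
  have "twist r ^ u = G"
    using G ud' deg by (intro poly_eq_if_eq_fun) (auto simp: poly_twist mult.commute simp flip: power_mult)
  thus False using G(1) deg ud by simp
qed

text \<open>
  The same comparison for the product of the \<open>h\<close>-th powers of two different twists, whose degree is at
  most \<open>2h * repunit k = 2m\<close>. The exponent \<open>h + h * p^(s-r)\<close> of \<open>f^(p^r)\<close> is one with a nonzero
  binomial coefficient.
\<close>

lemma degree_twist_add:
  assumes "r < s" "s < k"
  shows "degree (twist r) + degree (twist s) \<le> repunit k"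
proof -
  define t where "t = h + h * p ^ (s - r)"
  have t: "t * p ^ r = p ^ r * h + p ^ s * h"
    using assms by (simp add: t_def algebra_simps flip: power_add)
  have deg: "degree (twist r ^ h * twist s ^ h) = h * (degree (twist r) + degree (twist s))"
    by (simp add: degree_mult_eq twist_nonzero degree_power_eq algebra_simps)
  have "h * (degree (twist r) + degree (twist s)) \<le> h * (repunit k + repunit k)"
    using degree_twist_le by (intro mult_left_mono add_mono) auto
  also have "\<dots> = 2 * m" by (simp add: m_eq algebra_simps)
  finally have le: "h * (degree (twist r) + degree (twist s)) \<le> 2 * m" .
  obtain G where G: "degree G \<le> m" "\<And>x. poly G x = f x ^ (t * p ^ r)"
    using ex_low_degree_power[of t r] binomial_repunit_nonzero(3)[of "s - r" k] assms
    by (auto simp: m_eq t_def)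
  have "twist r ^ h * twist s ^ h = G"
    using G le deg by (intro poly_eq_if_eq_fun) (auto simp: poly_twist t power_add power_mult)
  hence "h * (degree (twist r) + degree (twist s)) \<le> h * repunit k"
    using G(1) deg m_eq by simp
  thus ?thesis using h_pos by simp
qed

text \<open>
  Raising \<open>f\<close> to the power \<open>p^r\<close> multiplies each exponent by \<open>p^r\<close> modulo \<open>2m = q - 1\<close>, a cyclic
  rotation of its \<open>k\<close> digits in base \<open>p\<close>. The hypothesis states this congruence of exponents as an
  equality of functions on the nonzero elements.
\<close>

lemma coeff_twist:
  assumes "i < 2 * m" "j < 2 * m" and eq: "\<And>x :: 'a. x \<noteq> 0 \<Longrightarrow> x ^ j = x ^ (i * p ^ r)"
  shows "coeff (twist r) j = coeff (twist 0) i ^ p ^ r"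
proof -
  have deg: "degree (twist r) < 2 * m" for r
    using degree_twist_le_m[of r] m_ge_2 by linarith
  have pow: "x ^ (2 * m - j) = (x ^ (2 * m - i)) ^ p ^ r" for x :: 'a
  proof (cases "x = 0")
    case True
    thus ?thesis using assms(1,2) prime_gt_0_nat[OF prime_p] by (simp add: power_0_left)
  next
    case False
    have "x ^ (2 * m - j) * x ^ j = 1"
      using assms(2) power_two_m[OF False] by (simp flip: power_add)
    moreover have "(x ^ (2 * m - i)) ^ p ^ r * x ^ j = 1"
      using assms(1) power_two_m[OF False] by (simp add: eq[OF False] power_mult flip: power_mult_distrib power_add)
    ultimately show ?thesis using False by (metis mult_right_cancel power_not_zero)
  qed
  have "coeff (twist 0) i ^ p ^ r = (- (\<Sum>x\<in>UNIV. f x * x ^ (2 * m - i))) ^ p ^ r"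
    using coeff_via_sum[OF deg assms(1)] by (simp add: poly_twist)
  also have "\<dots> = - ((\<Sum>x\<in>UNIV. f x * x ^ (2 * m - i)) ^ p ^ r)"
    using odd_CHAR by (simp add: p_CHAR)
  also have "(\<Sum>x\<in>UNIV. f x * x ^ (2 * m - i)) ^ p ^ r = (\<Sum>x\<in>UNIV. f x ^ p ^ r * x ^ (2 * m - j))"
    by (subst freshmans_dream_sum') (simp_all add: p_CHAR[symmetric] power_mult_distrib pow, simp add: p_CHAR)
  also have "- \<dots> = coeff (twist r) j"
    using coeff_via_sum[OF deg assms(2)] by (simp add: poly_twist)
  finally show ?thesis by simp
qed

lemma le_degree_twist:
  assumes "coeff (twist 0) i \<noteq> 0" "i < 2 * m" "j < 2 * m" "\<And>x :: 'a. x \<noteq> 0 \<Longrightarrow> x ^ j = x ^ (i * p ^ r)"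
  shows "j \<le> degree (twist r)"
  using coeff_twist[OF assms(2-)] assms(1) by (intro le_degree) auto

text \<open>
  A twist of degree at least \<open>p^(k-1)\<close> has an exponent with nonzero top digit. Two of them would make the
  sum of degrees at least \<open>2 * p^(k-1)\<close>, which exceeds \<open>repunit k\<close>.
\<close>

lemma unique_top_twist:
  assumes "r < k" "s < k" "p ^ (k - 1) \<le> degree (twist r)" "p ^ (k - 1) \<le> degree (twist s)"
  shows "r = s"
  using degree_twist_add[of r s] degree_twist_add[of s r] repunit_less[OF k_pos] assms
  by (cases r s rule: linorder_cases) auto

text \<open>
  Rotating the leading digit of \<open>j\<close>, at position \<open>l\<close>, to the top position \<open>k - 1\<close>.
\<close>

lemma digit_position:
  assumes "0 < j" "j < 2 * m"
  obtains l where "l < k" "p ^ l \<le> j" "j < p ^ Suc l" "j * p ^ (k - 1 - l) < 2 * m"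
    "p ^ (k - 1) \<le> j * p ^ (k - 1 - l)"
proof -
  have p2: "2 \<le> p" using prime_p by (rule prime_ge_2_nat)
  obtain l where l: "p ^ l \<le> j" "j < p ^ (l + 1)"
    using ex_power_ivl1[OF p2, of j] assms(1) by auto
  have "p ^ l < p ^ k" using l(1) assms(2) p_power by linarith
  hence lk: "l < k" using p2 by (metis power_less_imp_less_exp Suc_1 less_le_trans lessI)
  define r where "r = k - 1 - l"
  have "p ^ k = p ^ (l + 1) * p ^ r" "p ^ (k - 1) = p ^ l * p ^ r"
    using lk by (simp_all add: r_def flip: power_add del: power_Suc)
  moreover have "j * p ^ r < 2 * m"
  proof (cases "r = 0")
    case False
    have "2 \<le> p ^ r" using p2 False by (metis dual_order.trans self_le_power le_numeral_extra(4) bot_nat_0.not_eq_extremum one_le_numeral)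
    moreover have "(j + 1) * p ^ r \<le> p ^ (l + 1) * p ^ r" using l(2) by (intro mult_right_mono) auto
    hence "j * p ^ r + p ^ r \<le> 2 * m + 1"
      using \<open>p ^ k = p ^ (l + 1) * p ^ r\<close> p_power by (simp add: algebra_simps)
    ultimately show ?thesis by linarith
  qed (use assms in simp)
  moreover have "p ^ l * p ^ r \<le> j * p ^ r" using l(1) by (rule mult_right_mono) simp
  ultimately show ?thesis using that[of l] l lk by (simp add: r_def)
qed

text \<open>
  Each nonzero digit of an exponent of \<open>f\<close> can be rotated to the top by a twist of its own, so
  \<open>unique_top_twist\<close> allows just one nonzero digit; and it is \<open>1\<close>, because the rotated exponent is at
  most \<open>repunit k < 2 * p^(k-1)\<close>.
\<close>

lemma exponent_is_power:
  assumes j: "coeff (twist 0) j \<noteq> 0" "j > 0"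
  shows "\<exists>l<k. j = p ^ l \<and> p ^ (k - 1) \<le> degree (twist (k - 1 - l))"
proof -
  have "j \<le> m" using j(1) degree_twist_le_m[of 0] le_degree le_trans by blast
  hence j2m: "j < 2 * m" using m_ge_2 by linarith
  obtain l where l: "l < k" "p ^ l \<le> j" "j < p ^ Suc l" "j * p ^ (k - 1 - l) < 2 * m"
      "p ^ (k - 1) \<le> j * p ^ (k - 1 - l)"
    using digit_position[OF j(2) j2m] .
  define r where "r = k - 1 - l"
  have deg: "j * p ^ r \<le> degree (twist r)"
    using j(1) j2m l(4) by (intro le_degree_twist) (auto simp: r_def)
  hence top: "p ^ (k - 1) \<le> degree (twist r)" using l(5) by (simp add: r_def)
  have "j = p ^ l"
  proof (rule ccontr)
    define j' where "j' = j - p ^ l"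
    assume "j \<noteq> p ^ l"
    hence j': "0 < j'" "j = p ^ l + j'" using l(2) by (auto simp: j'_def)
    have "j * p ^ r < 2 * p ^ (k - 1)"
      using deg degree_twist_le[of r] repunit_less[OF k_pos] by linarith
    also have "p ^ (k - 1) = p ^ l * p ^ r" using l(1) by (simp add: r_def flip: power_add)
    finally have "j < 2 * p ^ l" by simp
    hence "j' < p ^ l" using j'(2) by simp
    obtain l' where l': "l' < k" "p ^ l' \<le> j'" "j' < p ^ Suc l'" "p ^ (k - 1) \<le> j' * p ^ (k - 1 - l')"
      using digit_position[OF j'(1)] j'(2) j2m by auto
    have "p ^ l' < p ^ l" using l'(2) \<open>j' < p ^ l\<close> by linarith
    hence "l' < l" using prime_ge_2_nat[OF prime_p] by (metis power_less_imp_less_exp Suc_1 less_le_trans lessI)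
    \<comment> \<open>The twist by \<open>p^s\<close> takes the second nonzero digit to the top; the leading digit wraps around to
      position \<open>i\<close>.\<close>
    define s where "s = k - 1 - l'"
    define i where "i = l - l' - 1"
    have s: "s < k" "s \<noteq> r" "s = Suc (s - 1)" "i \<le> s - 1" "l + s = k + i"
      using \<open>l' < l\<close> l(1) by (auto simp: s_def r_def i_def)
    have "p ^ i + j' * p ^ s < 2 * m"
    proof -
      have "(j' + 1) * p ^ s \<le> p ^ Suc l' * p ^ s" using l'(3) by (intro mult_right_mono) auto
      also have "\<dots> = p ^ k" using l'(1) by (simp add: s_def flip: power_add power_Suc)
      finally have "j' * p ^ s + p ^ s \<le> 2 * m + 1" using p_power by (simp add: algebra_simps)
      moreover have "p ^ s = p * p ^ (s - 1)" by (subst s(3)) simp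
      moreover have "p ^ i \<le> p ^ (s - 1)" using s(4) prime_gt_0_nat[OF prime_p] by (intro power_increasing) auto
      moreover have "3 * p ^ (s - 1) \<le> p * p ^ (s - 1)" using h_pos p_eq by (intro mult_right_mono) auto
      moreover have "p ^ (s - 1) \<ge> 1" using prime_gt_0_nat[OF prime_p] by simp
      ultimately show ?thesis by linarith
    qed
    moreover have "x ^ (p ^ i + j' * p ^ s) = x ^ (j * p ^ s)" for x :: 'a
    proof -
      have "j * p ^ s = p ^ k * p ^ i + j' * p ^ s"
        unfolding j'(2) by (simp add: algebra_simps s(5) flip: power_add)
      moreover have "x ^ p ^ k = x"
        using finite_field_power_card_eq_same[of x] by (simp add: p_power card_field)
      ultimately show ?thesis by (simp add: power_add power_mult)
    qed
    ultimately have "p ^ i + j' * p ^ s \<le> degree (twist s)"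
      using j(1) j2m by (intro le_degree_twist) auto
    hence "p ^ (k - 1) \<le> degree (twist s)" using l'(4) by (simp add: s_def)
    hence "s = r" using unique_top_twist[OF s(1) _ _ top] l(1) by (simp add: r_def)
    thus False using s(2) by simp
  qed
  thus ?thesis using l(1) top by (auto simp: r_def)
qed

text \<open>
  Two exponents of \<open>f\<close> at different positions would again give two twists of large degree.
\<close>

theorem quad_char_preserver_is_monomial:
  "\<exists>c\<in>P. \<exists>l\<le>k - 1. \<forall>x. f x = c * x ^ p ^ l"
proof -
  obtain l where l: "l < k" "\<And>j. coeff (twist 0) j \<noteq> 0 \<Longrightarrow> j > 0 \<Longrightarrow> j = p ^ l"
  proof (cases "\<exists>j>0. coeff (twist 0) j \<noteq> 0")
    case True
    then obtain j where "j > 0" "coeff (twist 0) j \<noteq> 0" by blast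
    from exponent_is_power[OF this(2,1)] obtain l where
      l: "l < k" "p ^ (k - 1) \<le> degree (twist (k - 1 - l))" by blast
    have "j' = p ^ l" if "coeff (twist 0) j' \<noteq> 0" "j' > 0" for j'
    proof -
      obtain l' where l': "l' < k" "j' = p ^ l'" "p ^ (k - 1) \<le> degree (twist (k - 1 - l'))"
        using exponent_is_power[OF \<open>coeff (twist 0) j' \<noteq> 0\<close> \<open>j' > 0\<close>] by blast
      have "k - 1 - l' = k - 1 - l"
        using unique_top_twist[OF _ _ l'(3) l(2)] k_pos by simp
      thus ?thesis using l' l(1) by (metis Suc_diff_1 k_pos diff_diff_cancel less_Suc_eq_le)
    qed
    thus ?thesis using that l(1) by blast
  next
    case False
    thus ?thesis using that[of 0] k_pos by blast
  qed
  define c where "c = coeff (twist 0) (p ^ l)"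
  have "coeff (twist 0) 0 = 0"
    using poly_twist[of 0 0] f0 by (simp add: poly_0_coeff_0)
  hence "twist 0 = monom c (p ^ l)"
    using l(2) by (intro poly_eqI) (metis coeff_monom c_def not_gr_zero)
  hence fx: "f x = c * x ^ p ^ l" for x
    using poly_twist[of 0 x] by (simp add: poly_monom)
  have "c \<in> P" using quad_char_preserver_one_pos fx[of 1] by simp
  thus ?thesis using fx l(1) by (intro bexI[of _ c] exI[of _ l]) auto
qed

end
end

section \<open>Injectivity on ternary matrices and the equivalences\<close>

context paley_field begin

text \<open>
  The difference of the squares of \<open>(t + 1/t)/2\<close> and \<open>(t - 1/t)/2\<close> is \<open>1\<close>, and both are nonzero once
  \<open>t\<^sup>4 \<noteq> 1\<close>. Such a \<open>t\<close> exists in every field of more than \<open>5\<close> elements.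
\<close>

lemma ex_square_above:
  assumes "m > 2" "u \<noteq> (0 :: 'a)"
  shows "\<exists>w\<in>P. w - u ^ 2 \<in> P"
proof -
  have "card {x :: 'a. x ^ 4 = 1} < card (UNIV - {0 :: 'a})"
    using card_power_fibre_le[of 4 1] assms(1) by (simp add: card_field card_Diff_singleton)
  hence "\<not> UNIV - {0 :: 'a} \<subseteq> {x. x ^ 4 = 1}"
    using card_mono[of "{x :: 'a. x ^ 4 = 1}"] by (metis finite leD)
  then obtain t :: 'a where t: "t \<noteq> 0" "t ^ 4 \<noteq> 1" by auto
  have nz: "t ^ 2 + 1 \<noteq> 0" "t ^ 2 - 1 \<noteq> 0"
  proof -
    have "(t ^ 2 + 1) * (t ^ 2 - 1) = t ^ 4 - 1" by (simp add: algebra_simps flip: power_add)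
    thus "t ^ 2 + 1 \<noteq> 0" "t ^ 2 - 1 \<noteq> 0" using t(2) by auto
  qed
  define w where "w = (u * (t ^ 2 + 1) / (2 * t)) ^ 2"
  have four: "(4 :: 'a) \<noteq> 0" using two_nonzero by (metis mult_2 mult_eq_0_iff numeral_Bit0)
  have "w - u ^ 2 = (u * (t ^ 2 - 1) / (2 * t)) ^ 2"
    using t(1) two_nonzero four
    by (simp add: w_def power_divide field_simps) (simp add: power2_eq_square algebra_simps)
  moreover have "(u * (t ^ 2 - 1) / (2 * t)) ^ 2 \<in> P" "w \<in> P"
    unfolding w_def using nz t(1) assms(2) two_nonzero by (intro square_in_pos_elems; simp)+
  ultimately show ?thesis by metis
qed

text \<open>
  In the field of \<open>5\<close> elements \<open>1\<close> and \<open>-1\<close> are the only nonzero squares, and their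
  difference is a nonsquare. Here a few binary matrices already determine the five values of \<open>f\<close>.
\<close>

lemma binary_preserver_card_5:
  fixes f :: "'a \<Rightarrow> 'a"
  assumes f: "preserves_binary_positivity f" and m: "m = 2"
  shows "f a = f 1 * a"
proof -
  have five: "(5 :: 'a) = 0" using two_m m by simp
  have three: "(3 :: 'a) \<noteq> 0"
  proof
    assume "(3 :: 'a) = 0"
    moreover have "(1 :: 'a) = 2 * 3 - 5" by simp
    ultimately show False using five by simp
  qed
  have P: "x \<in> P \<longleftrightarrow> x ^ 2 = 1" for x by (simp add: Euler_criterion m)
  have T: "(f a * f c - f b ^ 2) ^ 2 = 1" if "a ^ 2 = 1" "(a * c - b ^ 2) ^ 2 = 1" for a b c
    using f that unfolding preserves_binary_positivity_def P by blast
  define x y z s t where "x = f 1" and "y = f (- 1)" and "z = f 0" and "s = f 2" and "t = f (- 2)"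
  note defs = x_def y_def z_def s_def t_def
  have "x ^ 2 = 1" "y ^ 2 = 1"
    using binary_preserver_pos[OF f, of 1] binary_preserver_pos[OF f, of "- 1"] neg_one_pos
    by (simp_all add: P defs)
  have four: "(4 :: 'a) \<noteq> 0"
    using two_nonzero by (metis mult_2 mult_eq_0_iff numeral_Bit0)
  \<comment> \<open>The squares of \<open>-4\<close> and \<open>-6\<close>, the determinants of some of the matrices used below.\<close>
  have num: "(16 :: 'a) = 1" "(36 :: 'a) = 1"
  proof -
    have "(16 :: 'a) = 3 * 5 + 1" "(36 :: 'a) = 7 * 5 + 1" by simp_all
    thus "(16 :: 'a) = 1" "(36 :: 'a) = 1" by (simp_all add: five)
  qed
  have eqs: "(x * z - x ^ 2) ^ 2 = 1" "(y * z - y ^ 2) ^ 2 = 1" "(x * z - s ^ 2) ^ 2 = 1"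
      "(x * z - t ^ 2) ^ 2 = 1" "(x * s - x ^ 2) ^ 2 = 1" "(y * t - y ^ 2) ^ 2 = 1" "(x * t - s ^ 2) ^ 2 = 1"
    using T[of 1 0 1] T[of "- 1" 0 "- 1"] T[of 1 0 2] T[of 1 0 "- 2"] T[of 1 2 1]
      T[of "- 1" "- 2" "- 1"] T[of 1 "- 2" 2]
    by (simp_all add: defs num)
  have quadratic: "v = 0 \<or> v = 2 * w" if "w ^ 2 = 1" "(w * v - w ^ 2) ^ 2 = 1" for v w :: 'a
  proof -
    have "(w * v - w ^ 2) ^ 2 = w ^ 2 * (v - w) ^ 2"
      by (simp add: power2_eq_square algebra_simps)
    hence "(v - w) ^ 2 = w ^ 2" using that by simp
    hence "v - w = w \<or> v - w = - w" by (simp only: power2_eq_iff)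
    thus ?thesis by (auto simp: diff_eq_eq)
  qed
  have zst: "z = 0 \<or> z = 2 * x" "z = 0 \<or> z = 2 * y" "s = 0 \<or> s = 2 * x" "t = 0 \<or> t = 2 * y"
    by (rule quadratic; fact eqs \<open>x ^ 2 = 1\<close> \<open>y ^ 2 = 1\<close>)+
  have ne: "(x * (2 * x) - 0 ^ 2) ^ 2 \<noteq> 1" "(x * (2 * x) - (2 * x) ^ 2) ^ 2 \<noteq> 1"
  proof -
    have "(x * (2 * x) - 0 ^ 2) ^ 2 = 4 * (x ^ 2) ^ 2" "(x * (2 * x) - (2 * x) ^ 2) ^ 2 = 4 * (x ^ 2) ^ 2"
      by (simp_all add: power2_eq_square algebra_simps)
    moreover have "(4 :: 'a) \<noteq> 1"
    proof
      assume "(4 :: 'a) = 1"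
      moreover have "(3 :: 'a) = 4 - 1" by simp
      ultimately show False using three by simp
    qed
    ultimately show "(x * (2 * x) - 0 ^ 2) ^ 2 \<noteq> 1" "(x * (2 * x) - (2 * x) ^ 2) ^ 2 \<noteq> 1"
      using \<open>x ^ 2 = 1\<close> by simp_all
  qed
  have "z = 0"
    using zst(1,3) eqs(3) ne by metis
  hence "s \<noteq> 0" "t \<noteq> 0" using eqs(3,4) by auto
  hence st: "s = 2 * x" "t = 2 * y" using zst by auto
  have "y \<noteq> x" using eqs(7) st ne(2) by metis
  hence y: "y = - x" using \<open>x ^ 2 = 1\<close> \<open>y ^ 2 = 1\<close> by (metis power2_eq_iff)
  have one_two: "(1 :: 'a) \<noteq> 2" by (metis add_cancel_right_right one_add_one one_neq_zero)
  have "{0, 1, - 1, 2, - 2 :: 'a} = UNIV"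
  proof (rule card_subset_eq)
    have "(1 :: 'a) \<noteq> - 1" "(2 :: 'a) \<noteq> - 2" "(1 :: 'a) \<noteq> 2" "(1 :: 'a) \<noteq> - 2" "(- 1 :: 'a) \<noteq> 2" "(- 1 :: 'a) \<noteq> - 2"
      using three two_nonzero four one_two by (auto simp: eq_neg_iff_add_eq_0 neg_eq_iff_add_eq_0)
    thus "card {0, 1, - 1, 2, - 2 :: 'a} = card (UNIV :: 'a set)"
      using two_nonzero by (simp add: card_field m)
  qed auto
  hence "a \<in> {0, 1, - 1, 2, - 2}" by simp
  thus ?thesis using \<open>z = 0\<close> st y by (auto simp: defs)
qed

text \<open>
  The separating ternary matrix needs a square \<open>w\<close> for which \<open>w - u\<^sup>2\<close> is again a nonzero square; this
  fails only in the field of \<open>5\<close> elements.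
\<close>

theorem ternary_preserver_inj:
  fixes f :: "'a \<Rightarrow> 'a"
  assumes "preserves_positivity 3 f"
  shows "inj f"
proof (cases "m = 2")
  case True
  have bin: "preserves_binary_positivity f"
    using preserves_positivity_mono[OF assms, of 2] by (intro preserves_binary_positivity_if_2) simp
  have "f 1 \<noteq> 0" using binary_preserver_pos[OF bin, of 1] by auto
  thus ?thesis
    using binary_preserver_card_5[OF bin True] by (intro injI) (metis mult_left_cancel)
next
  case False
  hence "m > 2" using m_ge_2 by simp
  show ?thesis
  proof (rule injI)
    fix u v assume eq: "f u = f v"
    have "\<exists>w\<in>P. w - u ^ 2 \<in> P"
    proof (cases "u = 0")
      case True
      thus ?thesis by (intro bexI[of _ 1]) simp_all
    qed (rule ex_square_above[OF \<open>m > 2\<close>])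
    thus "u = v"
      using preserves_positivity_3_separates[OF assms neg_one_pos _ _ eq] by blast
  qed
qed

end

lemma Frobenius_automorphism:
  "field_automorphism (\<lambda>x :: 'a::finite_field. x ^ CHAR('a) ^ l)"
proof -
  have hom: "field_hom (\<lambda>x :: 'a. x ^ CHAR('a) ^ l)"
    by unfold_locales (simp_all add: freshmans_dream' power_mult_distrib power_0_left)
  interpret field_hom "\<lambda>x :: 'a. x ^ CHAR('a) ^ l" by (rule hom)
  have "inj (\<lambda>x :: 'a. x ^ CHAR('a) ^ l)" by (rule injI) (rule injectivity)
  thus ?thesis
    using hom finite_UNIV_inj_surj[of "\<lambda>x :: 'a. x ^ CHAR('a) ^ l"]
    by (simp add: field_automorphism_def bij_def)
qed

theorem theorem3:
  fixes f :: "'a::finite_field \<Rightarrow> 'a" and p k :: nat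
  assumes "prime p" and "k \<ge> 1" and "card (UNIV :: 'a set) = p ^ k"
    and "card (UNIV :: 'a set) mod 4 = 1"
  shows
    "((\<exists>n\<ge>3. preserves_positivity n f) \<longleftrightarrow> (\<forall>n\<ge>3. preserves_positivity n f))
   \<and> ((\<forall>n\<ge>3. preserves_positivity n f) \<longleftrightarrow>
        (f 0 = 0 \<and> (\<forall>a b. quad_char (f a - f b) = quad_char (a - b))))
   \<and> ((f 0 = 0 \<and> (\<forall>a b. quad_char (f a - f b) = quad_char (a - b))) \<longleftrightarrow>
        (\<exists>c\<in>pos_elems. \<exists>\<sigma>. field_automorphism \<sigma> \<and> (\<forall>x. f x = c * \<sigma> x)))
   \<and> ((\<exists>c\<in>pos_elems. \<exists>\<sigma>. field_automorphism \<sigma> \<and> (\<forall>x. f x = c * \<sigma> x)) \<longleftrightarrow>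
        (\<exists>c\<in>pos_elems. \<exists>l. l \<le> k - 1 \<and> (\<forall>x. f x = c * x ^ (p ^ l))))
   \<and> ((\<exists>r::int. odd r \<and> int (card (UNIV :: 'a set)) = r ^ 2) \<longrightarrow>
        ((\<exists>n\<ge>2. preserves_positivity n f) \<longleftrightarrow> (\<exists>n\<ge>3. preserves_positivity n f)))"
proof -
  define m where "m = (card (UNIV :: 'a set) - 1) div 2"
  have m: "card (UNIV :: 'a set) = 2 * m + 1" "even m"
    using assms(4) unfolding m_def by presburger+
  interpret paley_field "TYPE('a)" m by unfold_locales (fact m)+
  have "of_nat (2 * m + 1) = (0 :: 'a)" using two_m by simp
  hence "CHAR('a) dvd p ^ k"
    using m(1) assms(3) by (simp only: of_nat_eq_0_iff_char_dvd)
  hence "CHAR('a) dvd p" by (rule prime_dvd_power[OF CHAR_prime])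
  hence p: "p = CHAR('a)" using primes_dvd_imp_eq[OF CHAR_prime[where ?'a = 'a] assms(1)] by simp
  have pk: "p ^ k = 2 * m + 1" using m(1) assms(3) by simp
  obtain h where h: "p = 2 * h + 1" using odd_CHAR p by (metis oddE)
  interpret paley_field_power "TYPE('a)" m p k h
    by (intro paley_field_power.intro paley_field_power_axioms.intro paley_field_axioms p pk h)

  let ?quad = "f 0 = 0 \<and> (\<forall>a b. quad_char (f a - f b) = quad_char (a - b))"
  let ?auto = "\<exists>c\<in>pos_elems. \<exists>\<sigma>. field_automorphism \<sigma> \<and> (\<forall>x. f x = c * \<sigma> x)"
  let ?frob = "\<exists>c\<in>pos_elems. \<exists>l. l \<le> k - 1 \<and> (\<forall>x. f x = c * x ^ (p ^ l))"
  have quad: ?quad if "preserves_positivity n f" "n \<ge> 3" for n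
  proof (rule injective_binary_preserver_quad_char)
    show "inj f"
      using preserves_positivity_mono[OF that(1), of 3] that(2) by (intro ternary_preserver_inj) simp
    show "preserves_binary_positivity f"
      using preserves_positivity_mono[OF that(1), of 2] that(2)
      by (intro preserves_binary_positivity_if_2) simp
  qed
  have quad_frob: "?quad \<Longrightarrow> ?frob"
    using quad_char_preserver_is_monomial[of f] by blast
  have frob_auto: "?frob \<Longrightarrow> ?auto"
    using Frobenius_automorphism[where ?'a = 'a] unfolding p by blast
  have auto_all: "preserves_positivity n f" if ?auto for n
  proof -
    obtain c \<sigma> where c: "c \<in> pos_elems" "field_automorphism \<sigma>" "\<And>x. f x = c * \<sigma> x"
      using \<open>?auto\<close> by blast
    have "f = (\<lambda>x. c * \<sigma> x)" using c(3) by blast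
    thus ?thesis
      using c(1,2) scaled_field_hom_preserves_positivity unfolding field_automorphism_def by metis
  qed
  have square: ?quad if "odd r" "int (card (UNIV :: 'a set)) = r ^ 2" "n \<ge> 2" "preserves_positivity n f"
    for r :: int and n
  proof -
    define s where "s = nat \<bar>r\<bar>"
    have "int (s ^ 2) = int (p ^ k)" using that(2) by (simp add: s_def assms(3))
    hence s: "s ^ 2 = p ^ k" by (simp only: of_nat_eq_iff)
    hence "s dvd p ^ k" by (metis dvd_triv_left power2_eq_square)
    then obtain e where "s = p ^ e" using divides_primepow_nat[OF assms(1)] by blast
    hence "s ^ 2 = 2 * m + 1" "s = CHAR('a) ^ e" using s pk p by simp_all
    then interpret paley_field_square "TYPE('a)" m s e by unfold_locales
    have bin: "preserves_binary_positivity f"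
      using preserves_positivity_mono[OF that(4), of 2] that(3)
      by (intro preserves_binary_positivity_if_2) simp
    show ?thesis
      by (rule injective_binary_preserver_quad_char[OF bin binary_preserver_inj[OF bin]])
  qed
  have quad_all: "?quad \<longleftrightarrow> (\<forall>n\<ge>3. preserves_positivity n f)" "?quad \<longleftrightarrow> (\<exists>n\<ge>3. preserves_positivity n f)"
    "?quad \<longleftrightarrow> ?auto" "?auto \<longleftrightarrow> ?frob"
    using quad quad_frob frob_auto auto_all by (meson order_refl)+
  have from_2: "(\<exists>n\<ge>2. preserves_positivity n f) \<longleftrightarrow> (\<exists>n\<ge>3. preserves_positivity n f)"
    if "\<exists>r::int. odd r \<and> int (card (UNIV :: 'a set)) = r ^ 2"
  proof
    assume "\<exists>n\<ge>2. preserves_positivity n f"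
    thus "\<exists>n\<ge>3. preserves_positivity n f"
      using that square quad_all(2) by blast
  next
    assume "\<exists>n\<ge>3. preserves_positivity n f"
    then obtain n where "n \<ge> 3" "preserves_positivity n f" by blast
    thus "\<exists>n\<ge>2. preserves_positivity n f" by (intro exI[of _ n]) simp
  qed
  show ?thesis
  proof (intro conjI impI)
    show "(\<exists>n\<ge>3. preserves_positivity n f) \<longleftrightarrow> (\<forall>n\<ge>3. preserves_positivity n f)"
      by (rule trans[OF quad_all(2)[symmetric] quad_all(1)])
  qed (fact quad_all(1)[symmetric] quad_all(3,4) from_2)+
qed

end
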